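(* Let $p$ be a prime which satisfies $$r_Q(p)=r_Q(1)\big(1+\chi(p)p\big)\qquad\text{or}\qquad r_Q(p^2)=r_Q(1)\big(1+\chi(p)p+p^2\big).$$ Then $$r_Q(p^2n)=\frac{r_Q(p^2)\,r_Q(n)}{r_Q(1)}\quad\text{for every integer } n\geq 1 \text{ prime to } p.$$
   Context: $Q$ is the quadratic form $Q(x_1,x_2,x_3,x_4)=x_1^2+2x_2^2+x_3^2+x_4^2+x_1x_3+x_1x_4+x_2x_4$, which is positive definite, and for integers $n\ge 0$, $r_Q(n)=\#\{\mathbf{x}\in\mathbb{Z}^4:Q(\mathbf{x})=n\}$. $\chi$ is the Dirichlet character modulo $13$ given by the Kronecker symbol $\chi(d)=\big(\frac{13}{d}\big)$ for $d\in\mathbb{Z}$ with $13\nmid d$, and $\chi(d)=0$ if $13\mid d$. *)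

theory Defs
  imports "HOL-Number_Theory.Number_Theory"
begin

definition Q :: "int \<times> int \<times> int \<times> int \<Rightarrow> int" where
  "Q = (\<lambda>(x1, x2, x3, x4).
     x1\<^sup>2 + 2 * x2\<^sup>2 + x3\<^sup>2 + x4\<^sup>2 + x1 * x3 + x1 * x4 + x2 * x4)"

definition r_Q :: "nat \<Rightarrow> nat" where
  "r_Q n = card {x. Q x = int n}"

lemma Q_sum_of_squares:
  "24 * Q (x1, x2, x3, x4) =
     6 * (2 * x1 + x3 + x4)\<^sup>2 + 3 * (4 * x2 + x4)\<^sup>2 + 2 * (3 * x3 - x4)\<^sup>2 + 13 * x4\<^sup>2"
  by (simp add: Q_def power2_eq_square algebra_simps)

text \<open>The sets counted by \<^const>\<open>r_Q\<close> are finite, so that \<^const>\<open>card\<close> is their true cardinality.\<close>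

lemma finite_Q_eq: "finite {x. Q x = int n}"
proof (rule finite_subset)
  let ?I = "{- (100 * int n) .. 100 * int n}"
  show "finite (?I \<times> ?I \<times> ?I \<times> ?I)" by simp
  show "{x. Q x = int n} \<subseteq> ?I \<times> ?I \<times> ?I \<times> ?I"
  proof
    fix x assume "x \<in> {x. Q x = int n}"
    moreover obtain x1 x2 x3 x4 where x: "x = (x1, x2, x3, x4)" by (cases x)
    ultimately have eq: "24 * int n =
      6 * (2 * x1 + x3 + x4)\<^sup>2 + 3 * (4 * x2 + x4)\<^sup>2 + 2 * (3 * x3 - x4)\<^sup>2 + 13 * x4\<^sup>2"
      using Q_sum_of_squares[of x1 x2 x3 x4] by simp
    have abs_le: "\<bar>y\<bar> \<le> y\<^sup>2" for y :: int
      using self_le_power[of "\<bar>y\<bar>" 2] by (cases "y = 0") auto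
    have "\<bar>2 * x1 + x3 + x4\<bar> \<le> 24 * int n \<and> \<bar>4 * x2 + x4\<bar> \<le> 24 * int n
        \<and> \<bar>3 * x3 - x4\<bar> \<le> 24 * int n \<and> \<bar>x4\<bar> \<le> 24 * int n"
      using eq abs_le[of "2 * x1 + x3 + x4"] abs_le[of "4 * x2 + x4"] abs_le[of "3 * x3 - x4"]
        abs_le[of x4] by linarith
    then have "x1 \<in> ?I \<and> x2 \<in> ?I \<and> x3 \<in> ?I \<and> x4 \<in> ?I"
      unfolding atLeastAtMost_iff by linarith
    then show "x \<in> ?I \<times> ?I \<times> ?I \<times> ?I" using x by simp
  qed
qed

text \<open>The Kronecker symbol \<open>(a/q)\<close> at a positive prime \<open>q\<close>.\<close>

definition kronecker_prime :: "int \<Rightarrow> int \<Rightarrow> int" where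
  "kronecker_prime a q =
     (if q = 2 then (if even a then 0 else if a mod 8 = 1 \<or> a mod 8 = 7 then 1 else - 1)
      else Legendre a q)"

text \<open>The Kronecker symbol \<open>(a/n)\<close>. Over the integers, \<^const>\<open>prime_factors\<close> yields
  positive primes; the sign is the symbol at the unit \<open>sgn n\<close>, that is \<open>(a/-1)\<close> for negative \<open>n\<close>.\<close>

definition kronecker :: "int \<Rightarrow> int \<Rightarrow> int" where
  "kronecker a n =
     (if n = 0 then (if \<bar>a\<bar> = 1 then 1 else 0)
      else (if n < 0 \<and> a < 0 then - 1 else 1) *
        (\<Prod>q\<in>prime_factors n. kronecker_prime a q ^ multiplicity q n))"

definition chi :: "int \<Rightarrow> int" where
  "chi d = (if 13 dvd d then 0 else kronecker 13 d)"

end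

theory Submission
  imports Defs "HOL-Library.Product_Plus"
begin

text \<open>
  The form \<open>Q\<close> is positive definite, its Gram matrix has determinant \<open>13\<close>, and by
  \<open>class_number_one\<close> every positive definite integral quaternary form with this determinant is
  equivalent to \<open>Q\<close>. The theorem follows by counting vectors in Kneser neighbours of the lattice
  \<open>L = \<int>\<^sup>4\<close> carrying \<open>Q\<close>.

  Write \<open>b\<close> for the polar form of \<open>Q\<close>. For a prime \<open>p\<close> and a vector \<open>y\<close> that is isotropic and not
  in the radical modulo \<open>p\<close>, choose \<open>y' \<equiv> y (mod p)\<close> with \<open>p\<^sup>2\<close> dividing \<open>Q(y')\<close>. The neighbour
  \<open>L\<^sub>y = \<int> (y'/p) + {x \<in> L. p dvd b(x, y)}\<close> is again an integral lattice of determinant \<open>13\<close>, hence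
  isometric to \<open>L\<close>, and therefore has_basis_form \<open>n\<close> exactly \<open>r\<^sub>Q(n)\<close> times. A vector of norm \<open>n\<close> in \<open>L\<^sub>y\<close>
  either lies in \<open>L\<close> and is orthogonal to \<open>y\<close> modulo \<open>p\<close>, or it is \<open>z/p\<close> with \<open>z \<in> L\<close>, \<open>Q(z) = p\<^sup>2 n\<close>,
  and \<open>z\<close> spanning the same line as \<open>y\<close> modulo \<open>p\<close>; the lemma \<open>nbr_count_eq\<close> states the resulting
  count. Summing over all admissible residues \<open>y\<close> and exchanging the sums gives
  \<open>neighbour_identity\<close>, in which \<open>r\<^sub>Q(n)\<close> and \<open>r\<^sub>Q(p\<^sup>2 n)\<close> are linked by the numbers of admissible \<open>y\<close>
  orthogonal to the vectors \<open>w\<close> with \<open>Q(w) = n\<close>.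

  If \<open>p \<noteq> 13\<close> and \<open>p\<close> does not divide \<open>n\<close>, then the orthogonal complement of \<open>w\<close> modulo \<open>p\<close> contains
  exactly \<open>p\<^sup>2 - 1\<close> nonzero isotropic vectors, whatever \<open>w\<close> is (\<open>card_cone_perp\<close>): for odd \<open>p\<close> it is a
  nondegenerate ternary quadratic space. Hence \<open>(p - 1) r\<^sub>Q(p\<^sup>2 n) = K r\<^sub>Q(n)\<close> with a constant \<open>K\<close> that
  depends on \<open>p\<close> only (\<open>hecke_relation\<close>), and comparing \<open>n\<close> with \<open>1\<close> gives the claim.

  It remains to see that the hypothesis excludes \<open>p = 13\<close>. As \<open>\<chi>(13) = 0\<close>, it would say
  \<open>r\<^sub>Q(13) = r\<^sub>Q(1)\<close> or \<open>r\<^sub>Q(169) = 170 r\<^sub>Q(1)\<close>. But \<open>r\<^sub>Q(1) \<le> 12 < r\<^sub>Q(13)\<close>, and the neighbour identity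
  at \<open>13\<close> gives \<open>r\<^sub>Q(169) = 183 r\<^sub>Q(1)\<close>: modulo \<open>13\<close> the quotient of \<open>L\<close> by its radical is a ternary
  space, in which no vector of norm \<open>1\<close> is orthogonal to a nonzero isotropic one.
\<close>

section \<open>Integral quaternary forms and unimodular substitutions\<close>

text \<open>Vectors stay atomic unless their coordinates are introduced explicitly.\<close>

declare split_paired_All [simp del] split_paired_Ex [simp del]

type_synonym vec = "int \<times> int \<times> int \<times> int"

definition qform :: "int \<Rightarrow> int \<Rightarrow> int \<Rightarrow> int \<Rightarrow> int \<Rightarrow> int \<Rightarrow> int \<Rightarrow> int \<Rightarrow> int \<Rightarrow> int \<Rightarrow> vec \<Rightarrow> int" where
  "qform a b c d s t u v w z = (\<lambda>(x1, x2, x3, x4).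
     a * x1\<^sup>2 + b * x2\<^sup>2 + c * x3\<^sup>2 + d * x4\<^sup>2
     + s * x1 * x2 + t * x1 * x3 + u * x1 * x4 + v * x2 * x3 + w * x2 * x4 + z * x3 * x4)"

text \<open>The determinant of the Gram matrix, with diagonal \<open>2a, 2b, 2c, 2d\<close> and off-diagonal entries
  \<open>s, t, u, v, w, z\<close> read row by row.\<close>

definition disc4 :: "int \<Rightarrow> int \<Rightarrow> int \<Rightarrow> int \<Rightarrow> int \<Rightarrow> int \<Rightarrow> int \<Rightarrow> int \<Rightarrow> int \<Rightarrow> int \<Rightarrow> int" where
  "disc4 a b c d s t u v w z =
     16*a*b*c*d - 4*a*b*z\<^sup>2 - 4*a*c*w\<^sup>2 - 4*a*d*v\<^sup>2 - 4*b*c*u\<^sup>2 - 4*b*d*t\<^sup>2 - 4*c*d*s\<^sup>2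
     + 4*a*v*w*z + 4*b*t*u*z + 4*c*s*u*w + 4*d*s*t*v + s\<^sup>2*z\<^sup>2 + t\<^sup>2*w\<^sup>2 + u\<^sup>2*v\<^sup>2
     - 2*s*t*w*z - 2*s*u*v*z - 2*t*u*v*w"

text \<open>The Gram determinant of the restriction to the first three basis vectors.\<close>

definition disc3 :: "int \<Rightarrow> int \<Rightarrow> int \<Rightarrow> int \<Rightarrow> int \<Rightarrow> int \<Rightarrow> int" where
  "disc3 a b c s t v = 8*a*b*c + 2*s*t*v - 2*a*v\<^sup>2 - 2*b*t\<^sup>2 - 2*c*s\<^sup>2"

definition swap12 :: "vec \<Rightarrow> vec" where "swap12 = (\<lambda>(x1, x2, x3, x4). (x2, x1, x3, x4))"
definition swap23 :: "vec \<Rightarrow> vec" where "swap23 = (\<lambda>(x1, x2, x3, x4). (x1, x3, x2, x4))"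
definition swap34 :: "vec \<Rightarrow> vec" where "swap34 = (\<lambda>(x1, x2, x3, x4). (x1, x2, x4, x3))"
definition negate1 :: "vec \<Rightarrow> vec" where "negate1 = (\<lambda>(x1, x2, x3, x4). (- x1, x2, x3, x4))"
definition shear12 :: "int \<Rightarrow> vec \<Rightarrow> vec" where "shear12 k = (\<lambda>(x1, x2, x3, x4). (x1 + k * x2, x2, x3, x4))"

text \<open>The group \<open>GL\<^sub>4(\<int>)\<close>, presented by generators. The inductive presentation reduces each
  invariance statement, notably that of the determinant, to five explicit substitutions.\<close>

inductive unimod :: "(vec \<Rightarrow> vec) \<Rightarrow> bool" where
  unimod_id: "unimod (\<lambda>x. x)"
| unimod_swap12: "unimod \<phi> \<Longrightarrow> unimod (\<phi> \<circ> swap12)"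
| unimod_swap23: "unimod \<phi> \<Longrightarrow> unimod (\<phi> \<circ> swap23)"
| unimod_swap34: "unimod \<phi> \<Longrightarrow> unimod (\<phi> \<circ> swap34)"
| unimod_negate1: "unimod \<phi> \<Longrightarrow> unimod (\<phi> \<circ> negate1)"
| unimod_shear12: "unimod \<phi> \<Longrightarrow> unimod (\<phi> \<circ> shear12 k)"

lemma unimod_comp:
  assumes "unimod \<phi>" "unimod \<psi>"
  shows "unimod (\<phi> \<circ> \<psi>)"
  using assms(2)
proof induction
  case unimod_id
  then show ?case using assms(1) by (simp add: o_def)
qed (use unimod.intros in \<open>simp_all only: comp_assoc[symmetric]\<close>)

lemmas generator_defs = swap12_def swap23_def swap34_def negate1_def shear12_def

lemma unimod_gens: "unimod swap12" "unimod swap23" "unimod swap34" "unimod negate1" "unimod (shear12 k)"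
  using unimod.intros(2-6)[OF unimod_id] by (simp_all add: o_def)

lemma unimod_swaps:
  "unimod (\<lambda>(x1, x2, x3, x4). (x3, x2, x1, x4))"
  "unimod (\<lambda>(x1, x2, x3, x4). (x4, x2, x3, x1))"
  "unimod (\<lambda>(x1, x2, x3, x4). (x1, x4, x3, x2))"
proof -
  have 1: "(\<lambda>(x1, x2, x3, x4). (x3, x2, x1, x4)) = swap12 \<circ> (swap23 \<circ> swap12)"
    by (auto simp: generator_defs)
  show "unimod (\<lambda>(x1, x2, x3, x4). (x3, x2, x1, x4))"
    unfolding 1 by (intro unimod_comp unimod_gens)
  have 2: "(\<lambda>(x1, x2, x3, x4). (x1, x4, x3, x2)) = swap23 \<circ> (swap34 \<circ> swap23)"
    by (auto simp: generator_defs)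
  show 3: "unimod (\<lambda>(x1, x2, x3, x4). (x1, x4, x3, x2))"
    unfolding 2 by (intro unimod_comp unimod_gens)
  have 4: "(\<lambda>(x1, x2, x3, x4). (x4, x2, x3, x1)) = swap12 \<circ> ((\<lambda>(x1, x2, x3, x4). (x1, x4, x3, x2)) \<circ> swap12)"
    by (auto simp: generator_defs)
  show "unimod (\<lambda>(x1, x2, x3, x4). (x4, x2, x3, x1))"
    unfolding 4 by (intro unimod_comp unimod_gens 3)
qed

lemma unimod_conj:
  assumes "unimod \<sigma>" "unimod \<tau>" "\<theta> = \<sigma> \<circ> (\<tau> \<circ> \<sigma>)"
  shows "unimod \<theta>"
  unfolding assms(3) by (intro unimod_comp assms)

lemma unimod_shears:
  "unimod (\<lambda>(x1, x2, x3, x4). (x1 + k * x2, x2, x3, x4))"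
  "unimod (\<lambda>(x1, x2, x3, x4). (x1 + k * x3, x2, x3, x4))"
  "unimod (\<lambda>(x1, x2, x3, x4). (x1 + k * x4, x2, x3, x4))"
  "unimod (\<lambda>(x1, x2, x3, x4). (x1, x2 + k * x1, x3, x4))"
  "unimod (\<lambda>(x1, x2, x3, x4). (x1, x2 + k * x3, x3, x4))"
  "unimod (\<lambda>(x1, x2, x3, x4). (x1, x2 + k * x4, x3, x4))"
  "unimod (\<lambda>(x1, x2, x3, x4). (x1, x2, x3 + k * x1, x4))"
  "unimod (\<lambda>(x1, x2, x3, x4). (x1, x2, x3 + k * x2, x4))"
  "unimod (\<lambda>(x1, x2, x3, x4). (x1, x2, x3 + k * x4, x4))"
  "unimod (\<lambda>(x1, x2, x3, x4). (x1, x2, x3, x4 + k * x1))"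
  "unimod (\<lambda>(x1, x2, x3, x4). (x1, x2, x3, x4 + k * x2))"
proof -
  show 12: "unimod (\<lambda>(x1, x2, x3, x4). (x1 + k * x2, x2, x3, x4))"
    using unimod_gens(5)[of k] by (simp add: generator_defs)
  show 13: "unimod (\<lambda>(x1, x2, x3, x4). (x1 + k * x3, x2, x3, x4))"
    by (rule unimod_conj[OF unimod_gens(2) 12]) (auto simp: generator_defs)
  show 14: "unimod (\<lambda>(x1, x2, x3, x4). (x1 + k * x4, x2, x3, x4))"
    by (rule unimod_conj[OF unimod_gens(3) 13]) (auto simp: generator_defs)
  show 21: "unimod (\<lambda>(x1, x2, x3, x4). (x1, x2 + k * x1, x3, x4))"
    by (rule unimod_conj[OF unimod_gens(1) 12]) (auto simp: generator_defs)
  show 23: "unimod (\<lambda>(x1, x2, x3, x4). (x1, x2 + k * x3, x3, x4))"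
    by (rule unimod_conj[OF unimod_gens(1) 13]) (auto simp: generator_defs)
  show 24: "unimod (\<lambda>(x1, x2, x3, x4). (x1, x2 + k * x4, x3, x4))"
    by (rule unimod_conj[OF unimod_gens(1) 14]) (auto simp: generator_defs)
  show 31: "unimod (\<lambda>(x1, x2, x3, x4). (x1, x2, x3 + k * x1, x4))"
    by (rule unimod_conj[OF unimod_gens(2) 21]) (auto simp: generator_defs)
  show 32: "unimod (\<lambda>(x1, x2, x3, x4). (x1, x2, x3 + k * x2, x4))"
    by (rule unimod_conj[OF unimod_gens(2) 23]) (auto simp: generator_defs)
  show 34: "unimod (\<lambda>(x1, x2, x3, x4). (x1, x2, x3 + k * x4, x4))"
    by (rule unimod_conj[OF unimod_gens(2) 24]) (auto simp: generator_defs)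
  show 41: "unimod (\<lambda>(x1, x2, x3, x4). (x1, x2, x3, x4 + k * x1))"
    by (rule unimod_conj[OF unimod_gens(3) 31]) (auto simp: generator_defs)
  show 42: "unimod (\<lambda>(x1, x2, x3, x4). (x1, x2, x3, x4 + k * x2))"
    by (rule unimod_conj[OF unimod_gens(3) 32]) (auto simp: generator_defs)
qed

definition smul :: "int \<Rightarrow> vec \<Rightarrow> vec" where
  "smul k = (\<lambda>(x1, x2, x3, x4). (k * x1, k * x2, k * x3, k * x4))"

lemma gens_linear:
  "swap12 (x + y) = swap12 x + swap12 y" "swap12 (smul k x) = smul k (swap12 x)"
  "swap23 (x + y) = swap23 x + swap23 y" "swap23 (smul k x) = smul k (swap23 x)"
  "swap34 (x + y) = swap34 x + swap34 y" "swap34 (smul k x) = smul k (swap34 x)"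
  "negate1 (x + y) = negate1 x + negate1 y" "negate1 (smul k x) = smul k (negate1 x)"
  "shear12 l (x + y) = shear12 l x + shear12 l y" "shear12 l (smul k x) = smul k (shear12 l x)"
  by (auto simp: generator_defs smul_def algebra_simps split: prod.splits)

lemma gens_inverse:
  "swap12 (swap12 x) = x" "swap23 (swap23 x) = x" "swap34 (swap34 x) = x" "negate1 (negate1 x) = x"
  "shear12 l (shear12 (- l) x) = x" "shear12 (- l) (shear12 l x) = x"
  by (auto simp: generator_defs split: prod.splits)

lemma unimod_linear:
  assumes "unimod \<phi>"
  shows "\<phi> (x + y) = \<phi> x + \<phi> y" "\<phi> (smul k x) = smul k (\<phi> x)"
  using assms by (induction arbitrary: x y) (simp_all add: gens_linear)

lemma unimod_zero: "unimod \<phi> \<Longrightarrow> \<phi> 0 = 0"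
  using unimod_linear(1)[of \<phi> 0 0] by simp

lemma unimod_diff: "unimod \<phi> \<Longrightarrow> \<phi> (x - y) = \<phi> x - \<phi> y"
  using unimod_linear(1)[of \<phi> "x - y" y] by (simp add: algebra_simps)

lemma unimod_inverse:
  assumes "unimod \<phi>"
  shows "\<exists>\<psi>. unimod \<psi> \<and> (\<forall>x. \<phi> (\<psi> x) = x) \<and> (\<forall>x. \<psi> (\<phi> x) = x)"
  using assms
proof induction
  case unimod_id
  show ?case by (rule exI[of _ "\<lambda>x. x"]) (simp add: unimod.unimod_id)
next
  case (unimod_swap12 \<phi>)
  then obtain \<psi> where "unimod \<psi>" "\<forall>x. \<phi> (\<psi> x) = x" "\<forall>x. \<psi> (\<phi> x) = x" by blast
  then show ?case
    by (intro exI[of _ "swap12 \<circ> \<psi>"] conjI unimod_comp unimod_gens) (simp_all add: gens_inverse)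
next
  case (unimod_swap23 \<phi>)
  then obtain \<psi> where "unimod \<psi>" "\<forall>x. \<phi> (\<psi> x) = x" "\<forall>x. \<psi> (\<phi> x) = x" by blast
  then show ?case
    by (intro exI[of _ "swap23 \<circ> \<psi>"] conjI unimod_comp unimod_gens) (simp_all add: gens_inverse)
next
  case (unimod_swap34 \<phi>)
  then obtain \<psi> where "unimod \<psi>" "\<forall>x. \<phi> (\<psi> x) = x" "\<forall>x. \<psi> (\<phi> x) = x" by blast
  then show ?case
    by (intro exI[of _ "swap34 \<circ> \<psi>"] conjI unimod_comp unimod_gens) (simp_all add: gens_inverse)
next
  case (unimod_negate1 \<phi>)
  then obtain \<psi> where "unimod \<psi>" "\<forall>x. \<phi> (\<psi> x) = x" "\<forall>x. \<psi> (\<phi> x) = x" by blast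
  then show ?case
    by (intro exI[of _ "negate1 \<circ> \<psi>"] conjI unimod_comp unimod_gens) (simp_all add: gens_inverse)
next
  case (unimod_shear12 \<phi> k)
  then obtain \<psi> where "unimod \<psi>" "\<forall>x. \<phi> (\<psi> x) = x" "\<forall>x. \<psi> (\<phi> x) = x" by blast
  then show ?case
    by (intro exI[of _ "shear12 (- k) \<circ> \<psi>"] conjI unimod_comp unimod_gens) (simp_all add: gens_inverse)
qed

lemma unimod_bij: "unimod \<phi> \<Longrightarrow> bij \<phi>"
  using unimod_inverse[of \<phi>] by (metis bijI')

lemma unimod_eq_zero_iff: "unimod \<phi> \<Longrightarrow> \<phi> x = 0 \<longleftrightarrow> x = 0"
  by (metis unimod_bij unimod_zero bij_def injD)

definition quadratic :: "(vec \<Rightarrow> int) \<Rightarrow> bool" where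
  "quadratic f \<longleftrightarrow> (\<exists>a b c d s t u v w z. f = qform a b c d s t u v w z)"

definition pos_form13 :: "(vec \<Rightarrow> int) \<Rightarrow> bool" where
  "pos_form13 f \<longleftrightarrow> (\<exists>a b c d s t u v w z. f = qform a b c d s t u v w z \<and> disc4 a b c d s t u v w z = 13)
     \<and> (\<forall>x. x \<noteq> 0 \<longrightarrow> f x > 0)"

lemma pos_form13_quadratic: "pos_form13 f \<Longrightarrow> quadratic f"
  unfolding pos_form13_def quadratic_def by blast

lemma qform_comp_gens:
  "qform a b c d s t u v w z \<circ> swap12 = qform b a c d s v w t u z"
  "qform a b c d s t u v w z \<circ> swap23 = qform a c b d t s u v z w"
  "qform a b c d s t u v w z \<circ> swap34 = qform a b d c s u t w v z"
  "qform a b c d s t u v w z \<circ> negate1 = qform a b c d (- s) (- t) (- u) v w z"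
  "qform a b c d s t u v w z \<circ> shear12 k
     = qform a (b + k * s + k\<^sup>2 * a) c d (s + 2 * a * k) t u (v + k * t) (w + k * u) z"
  by (auto simp: qform_def generator_defs algebra_simps power2_eq_square)

lemma disc4_gens:
  "disc4 b a c d s v w t u z = disc4 a b c d s t u v w z"
  "disc4 a c b d t s u v z w = disc4 a b c d s t u v w z"
  "disc4 a b d c s u t w v z = disc4 a b c d s t u v w z"
  "disc4 a b c d (- s) (- t) (- u) v w z = disc4 a b c d s t u v w z"
  "disc4 a (b + k * s + k\<^sup>2 * a) c d (s + 2 * a * k) t u (v + k * t) (w + k * u) z
     = disc4 a b c d s t u v w z"
  by (simp_all add: disc4_def algebra_simps power2_eq_square)

lemma quadratic_gens:
  assumes "quadratic f"
  shows "quadratic (f \<circ> swap12)" "quadratic (f \<circ> swap23)" "quadratic (f \<circ> swap34)" "quadratic (f \<circ> negate1)"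
    "quadratic (f \<circ> shear12 k)"
  using assms unfolding quadratic_def by (elim exE, hypsubst, unfold qform_comp_gens, blast)+

lemma quadratic_unimod:
  assumes "unimod \<phi>" "quadratic f"
  shows "quadratic (f \<circ> \<phi>)"
  using assms
proof induction
  case unimod_id
  then show ?case by (simp add: o_def)
qed (simp_all only: quadratic_gens comp_assoc[symmetric])

lemma pos_form13I:
  assumes "f = qform a b c d s t u v w z" "disc4 a b c d s t u v w z = 13" "\<And>x. x \<noteq> 0 \<Longrightarrow> f x > 0"
  shows "pos_form13 f"
  using assms unfolding pos_form13_def by blast

lemma pos_form13E:
  assumes "pos_form13 f"
  obtains a b c d s t u v w z where "f = qform a b c d s t u v w z"
    "disc4 a b c d s t u v w z = 13" "\<And>x. x \<noteq> 0 \<Longrightarrow> f x > 0"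
  using assms unfolding pos_form13_def by blast

text \<open>Positivity survives because a substitution permutes the nonzero vectors.\<close>

lemma pos_form13_unimodI:
  assumes "pos_form13 f" "unimod \<phi>" "f \<circ> \<phi> = qform a b c d s t u v w z" "disc4 a b c d s t u v w z = 13"
  shows "pos_form13 (f \<circ> \<phi>)"
proof (rule pos_form13I[OF assms(3,4)])
  fix x :: vec assume "x \<noteq> 0"
  then show "(f \<circ> \<phi>) x > 0"
    using assms(1) unimod_eq_zero_iff[OF assms(2), of x] unfolding pos_form13_def by simp
qed

lemma pos_form13_gens:
  assumes "pos_form13 f"
  shows "pos_form13 (f \<circ> swap12)" "pos_form13 (f \<circ> swap23)" "pos_form13 (f \<circ> swap34)" "pos_form13 (f \<circ> negate1)"
    "pos_form13 (f \<circ> shear12 k)"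
proof -
  obtain a b c d s t u v w z where f: "f = qform a b c d s t u v w z"
    and D: "disc4 a b c d s t u v w z = 13" using assms by (rule pos_form13E)
  note step = pos_form13_unimodI[OF assms, unfolded f, OF unimod_gens(1) qform_comp_gens(1) disc4_gens(1)[THEN trans, OF D]]
    pos_form13_unimodI[OF assms, unfolded f, OF unimod_gens(2) qform_comp_gens(2) disc4_gens(2)[THEN trans, OF D]]
    pos_form13_unimodI[OF assms, unfolded f, OF unimod_gens(3) qform_comp_gens(3) disc4_gens(3)[THEN trans, OF D]]
    pos_form13_unimodI[OF assms, unfolded f, OF unimod_gens(4) qform_comp_gens(4) disc4_gens(4)[THEN trans, OF D]]
    pos_form13_unimodI[OF assms, unfolded f, OF unimod_gens(5) qform_comp_gens(5) disc4_gens(5)[THEN trans, OF D]]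
  show "pos_form13 (f \<circ> swap12)" "pos_form13 (f \<circ> swap23)" "pos_form13 (f \<circ> swap34)" "pos_form13 (f \<circ> negate1)"
    "pos_form13 (f \<circ> shear12 k)"
    unfolding f by (rule step)+
qed

lemma pos_form13_unimod:
  assumes "unimod \<phi>" "pos_form13 f"
  shows "pos_form13 (f \<circ> \<phi>)"
  using assms
proof induction
  case unimod_id
  then show ?case by (simp add: o_def)
qed (simp_all only: pos_form13_gens comp_assoc[symmetric])

section \<open>Reduction theory\<close>

text \<open>The form \<open>f\<close> has the given coefficients in some \<open>\<int>\<close>-basis. The reduction below works on
  coefficients, so it is stated for this relation.\<close>

definition has_basis_form :: "(vec \<Rightarrow> int) \<Rightarrow> int \<Rightarrow> int \<Rightarrow> int \<Rightarrow> int \<Rightarrow> int \<Rightarrow> int \<Rightarrow> int \<Rightarrow> int \<Rightarrow> int \<Rightarrow> int \<Rightarrow> bool" where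
  "has_basis_form f a b c d s t u v w z \<longleftrightarrow> (\<exists>\<phi>. unimod \<phi> \<and> f \<circ> \<phi> = qform a b c d s t u v w z)"

lemma has_basis_formD:
  assumes "has_basis_form f a b c d s t u v w z" "unimod \<psi>" "qform a b c d s t u v w z \<circ> \<psi> = qform a' b' c' d' s' t' u' v' w' z'"
  shows "has_basis_form f a' b' c' d' s' t' u' v' w' z'"
  using assms unfolding has_basis_form_def by (metis comp_assoc unimod_comp)

text \<open>The elementary changes of basis: transposition of neighbouring basis vectors, a sign change,
  and the addition of \<open>k\<close> times a basis vector to a later one.\<close>

lemma has_basis_form_moves:
  assumes "has_basis_form f a b c d s t u v w z"
  shows "has_basis_form f b a c d s v w t u z"
    and "has_basis_form f a c b d t s u v z w"
    and "has_basis_form f a b d c s u t w v z"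
    and "has_basis_form f a b c d (- s) (- t) (- u) v w z"
    and "has_basis_form f a (b + k * s + k\<^sup>2 * a) c d (s + 2 * a * k) t u (v + k * t) (w + k * u) z"
    and "has_basis_form f a b (c + k * v + k\<^sup>2 * b) d s (t + k * s) u (v + 2 * b * k) w (z + k * w)"
    and "has_basis_form f a b (c + k * t + k\<^sup>2 * a) d s (t + 2 * a * k) u (v + k * s) w (z + k * u)"
    and "has_basis_form f a b c (d + k * z + k\<^sup>2 * c) s t (u + k * t) v (w + k * v) (z + 2 * c * k)"
    and "has_basis_form f a b c (d + k * w + k\<^sup>2 * b) s t (u + k * s) v (w + 2 * b * k) (z + k * v)"
    and "has_basis_form f a b c (d + k * u + k\<^sup>2 * a) s t (u + 2 * a * k) v (w + k * s) (z + k * t)"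
  subgoal by (rule has_basis_formD[OF assms unimod_gens(1) qform_comp_gens(1)])
  subgoal by (rule has_basis_formD[OF assms unimod_gens(2) qform_comp_gens(2)])
  subgoal by (rule has_basis_formD[OF assms unimod_gens(3) qform_comp_gens(3)])
  subgoal by (rule has_basis_formD[OF assms unimod_gens(4) qform_comp_gens(4)])
  subgoal by (rule has_basis_formD[OF assms unimod_shears(1)[of k]]; auto simp: qform_def algebra_simps power2_eq_square)
  subgoal by (rule has_basis_formD[OF assms unimod_shears(5)[of k]]; auto simp: qform_def algebra_simps power2_eq_square)
  subgoal by (rule has_basis_formD[OF assms unimod_shears(2)[of k]]; auto simp: qform_def algebra_simps power2_eq_square)
  subgoal by (rule has_basis_formD[OF assms unimod_shears(9)[of k]]; auto simp: qform_def algebra_simps power2_eq_square)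
  subgoal by (rule has_basis_formD[OF assms unimod_shears(6)[of k]]; auto simp: qform_def algebra_simps power2_eq_square)
  subgoal by (rule has_basis_formD[OF assms unimod_shears(3)[of k]]; auto simp: qform_def algebra_simps power2_eq_square)
  done

lemma qform_inject:
  assumes "qform a b c d s t u v w z = qform a' b' c' d' s' t' u' v' w' z'"
  shows "a = a'" "b = b'" "c = c'" "d = d'" "s = s'" "t = t'" "u = u'" "v = v'" "w = w'" "z = z'"
  using fun_cong[OF assms, of "(1,0,0,0)"] fun_cong[OF assms, of "(0,1,0,0)"]
    fun_cong[OF assms, of "(0,0,1,0)"] fun_cong[OF assms, of "(0,0,0,1)"]
    fun_cong[OF assms, of "(1,1,0,0)"] fun_cong[OF assms, of "(1,0,1,0)"]
    fun_cong[OF assms, of "(1,0,0,1)"] fun_cong[OF assms, of "(0,1,1,0)"]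
    fun_cong[OF assms, of "(0,1,0,1)"] fun_cong[OF assms, of "(0,0,1,1)"]
  by (simp_all add: qform_def)

text \<open>Evaluating the form at \<open>(-s, 2a, 0, 0)\<close> and at a column of the adjugate of the leading
  \<open>3 \<times> 3\<close> Gram matrix exhibits the leading minors as positive factors of values of the form.\<close>

lemma pos_form13_qform:
  assumes "pos_form13 (qform a b c d s t u v w z)"
  shows "disc4 a b c d s t u v w z = 13" "a > 0" "4 * a * b - s\<^sup>2 > 0" "disc3 a b c s t v > 0"
proof -
  let ?q = "qform a b c d s t u v w z"
  obtain a' b' c' d' s' t' u' v' w' z' where "?q = qform a' b' c' d' s' t' u' v' w' z'"
    "disc4 a' b' c' d' s' t' u' v' w' z' = 13" and pos: "\<And>x. x \<noteq> 0 \<Longrightarrow> ?q x > 0"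
    using assms by (rule pos_form13E) metis
  then show "disc4 a b c d s t u v w z = 13" using qform_inject[of a b c d s t u v w z] by metis
  show a: "a > 0" using pos[of "(1,0,0,0)"] by (simp add: qform_def zero_prod_def)
  have "?q (- s, 2 * a, 0, 0) = a * (4 * a * b - s\<^sup>2)"
    by (simp add: qform_def algebra_simps power2_eq_square)
  then show D2: "4 * a * b - s\<^sup>2 > 0"
    using pos[of "(- s, 2 * a, 0, 0)"] a by (simp add: zero_prod_def zero_less_mult_iff)
  have "2 * ?q (s * v - 2 * b * t, s * t - 2 * a * v, 4 * a * b - s\<^sup>2, 0)
      = disc3 a b c s t v * (4 * a * b - s\<^sup>2)"
    by (simp add: qform_def disc3_def algebra_simps power2_eq_square)
  moreover have "?q (s * v - 2 * b * t, s * t - 2 * a * v, 4 * a * b - s\<^sup>2, 0) > 0"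
    by (rule pos) (use D2 in \<open>simp add: zero_prod_def\<close>)
  ultimately have "disc3 a b c s t v * (4 * a * b - s\<^sup>2) > 0" by linarith
  then show "disc3 a b c s t v > 0" using D2 by (simp add: zero_less_mult_iff)
qed

lemma has_basis_form_pos_form13:
  assumes "pos_form13 f" "has_basis_form f a b c d s t u v w z"
  shows "pos_form13 (qform a b c d s t u v w z)"
  using assms pos_form13_unimod unfolding has_basis_form_def by metis

text \<open>Rounding to the nearest multiple of \<open>D\<close>, as needed for size reduction.\<close>

lemma ex_centered_residue:
  fixes m D :: int
  assumes "D > 0"
  obtains k where "2 * \<bar>m + k * D\<bar> \<le> D"
proof
  define k where "k = - ((2 * m + D) div (2 * D))"
  have "2 * m + D = - k * (2 * D) + (2 * m + D) mod (2 * D)"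
    unfolding k_def using div_mult_mod_eq[of "2 * m + D" "2 * D"] by simp
  moreover have "0 \<le> (2 * m + D) mod (2 * D)" "(2 * m + D) mod (2 * D) < 2 * D"
    using assms by simp_all
  ultimately show "2 * \<bar>m + k * D\<bar> \<le> D" by (auto simp: abs_if algebra_simps)
qed

text \<open>Lattice basis reduction in the style of Lenstra, Lenstra and Lovasz with optimal parameter.
  The product of the first three leading minors depends only on the flag spanned by the basis, so
  size reduction does not change it, whereas transposing two neighbouring basis vectors replaces
  exactly one of the minors. In a basis that minimises the product no transposition can lower its
  minor; these are the last three inequalities.\<close>

lemma reduced_form_exists:
  assumes "pos_form13 f"
  obtains a b c d s t u v w z where "has_basis_form f a b c d s t u v w z"
    "\<bar>s\<bar> \<le> a" "\<bar>t\<bar> \<le> a" "2 * \<bar>2 * a * v - s * t\<bar> \<le> 4 * a * b - s\<^sup>2"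
    "2 * \<bar>4*a*b*z - 2*a*v*w - s\<^sup>2*z + s*t*w + s*u*v - 2*b*t*u\<bar> \<le> disc3 a b c s t v"
    "a \<le> b" "4 * a * b - s\<^sup>2 \<le> 4 * a * c - t\<^sup>2" "disc3 a b c s t v \<le> disc3 a b d s u w"
proof -
  \<comment> \<open>half the product of the leading minors \<open>2a\<close>, \<open>4ab - s\<^sup>2\<close> and \<open>disc3\<close>\<close>
  define \<mu> where "\<mu> a b c s t v = nat (a * ((4 * a * b - s\<^sup>2) * disc3 a b c s t v))" for a b c s t v
  define P where "P m \<longleftrightarrow> (\<exists>a b c d s t u v w z. has_basis_form f a b c d s t u v w z \<and> \<mu> a b c s t v = m)" for m
  define m where "m = (LEAST m. P m)"
  define Min where "Min a b c d s t u v w z \<longleftrightarrow> has_basis_form f a b c d s t u v w z \<and> \<mu> a b c s t v = m"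
    for a b c d s t u v w z
  obtain a b c d s t u v w z where "f = qform a b c d s t u v w z" using assms by (rule pos_form13E)
  then have "has_basis_form f a b c d s t u v w z"
    unfolding has_basis_form_def by (intro exI[of _ "\<lambda>x. x"]) (simp add: unimod_id o_def)
  then have "P (\<mu> a b c s t v)" unfolding P_def by (intro exI conjI) (assumption, rule refl)
  then have "P m" unfolding m_def by (rule LeastI)
  then obtain a b c d s t u v w z where 0: "Min a b c d s t u v w z"
    unfolding P_def Min_def by (elim exE) blast
  have least: "m \<le> \<mu> a b c s t v" if "has_basis_form f a b c d s t u v w z" for a b c d s t u v w z
    unfolding m_def by (rule Least_le, unfold P_def) (intro exI conjI, rule that, rule refl)
  note pos = pos_form13_qform[OF has_basis_form_pos_form13[OF assms]]
  have MinD: "has_basis_form f a b c d s t u v w z" "a > 0" "4 * a * b - s\<^sup>2 > 0" "disc3 a b c s t v > 0"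
    if "Min a b c d s t u v w z" for a b c d s t u v w z
  proof -
    show r: "has_basis_form f a b c d s t u v w z" using that unfolding Min_def by simp
    show "a > 0" "4 * a * b - s\<^sup>2 > 0" "disc3 a b c s t v > 0" using pos(2-4)[OF r] .
  qed
  obtain a b c d s t u v w z where 1: "Min a b c d s t u v w z" "\<bar>s\<bar> \<le> a"
  proof -
    obtain k where k: "2 * \<bar>s + k * (2 * a)\<bar> \<le> 2 * a"
      using ex_centered_residue[of "2 * a" s] MinD(2)[OF 0] by auto
    have k': "\<bar>s + 2 * a * k\<bar> \<le> a" using k by (simp add: algebra_simps)
    have "4 * a * (b + k * s + k\<^sup>2 * a) - (s + 2 * a * k)\<^sup>2 = 4 * a * b - s\<^sup>2"
      by (simp add: algebra_simps power2_eq_square)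
    moreover have "disc3 a (b + k * s + k\<^sup>2 * a) c (s + 2 * a * k) t (v + k * t) = disc3 a b c s t v"
      by (simp add: disc3_def algebra_simps power2_eq_square)
    ultimately show thesis
      using k' 0 has_basis_form_moves(5)[of f a b c d s t u v w z k]
      by (intro that[of a "b + k * s + k\<^sup>2 * a" c d "s + 2 * a * k" t u "v + k * t" "w + k * u" z])
         (simp_all add: Min_def \<mu>_def)
  qed
  obtain a b c d s t u v w z where 2: "Min a b c d s t u v w z" "\<bar>s\<bar> \<le> a"
    "2 * \<bar>2 * a * v - s * t\<bar> \<le> 4 * a * b - s\<^sup>2"
  proof -
    obtain k where k: "2 * \<bar>2 * a * v - s * t + k * (4 * a * b - s\<^sup>2)\<bar> \<le> 4 * a * b - s\<^sup>2"
      using ex_centered_residue MinD(3)[OF 1(1)] by blast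
    have "2 * a * (v + 2 * b * k) - s * (t + k * s) = 2 * a * v - s * t + k * (4 * a * b - s\<^sup>2)"
      by (simp add: algebra_simps power2_eq_square)
    moreover have "disc3 a b (c + k * v + k\<^sup>2 * b) s (t + k * s) (v + 2 * b * k) = disc3 a b c s t v"
      by (simp add: disc3_def algebra_simps power2_eq_square)
    ultimately show thesis
      using k 1 has_basis_form_moves(6)[of f a b c d s t u v w z k]
      by (intro that[of a b "c + k * v + k\<^sup>2 * b" d s "t + k * s" u "v + 2 * b * k" w "z + k * w"])
         (simp_all add: Min_def \<mu>_def)
  qed
  obtain a b c d s t u v w z where 3: "Min a b c d s t u v w z" "\<bar>s\<bar> \<le> a"
    "2 * \<bar>2 * a * v - s * t\<bar> \<le> 4 * a * b - s\<^sup>2" "\<bar>t\<bar> \<le> a"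
  proof -
    obtain k where k: "2 * \<bar>t + k * (2 * a)\<bar> \<le> 2 * a"
      using ex_centered_residue[of "2 * a" t] MinD(2)[OF 2(1)] by auto
    have k': "\<bar>t + 2 * a * k\<bar> \<le> a" using k by (simp add: algebra_simps)
    have "2 * a * (v + k * s) - s * (t + 2 * a * k) = 2 * a * v - s * t"
      by (simp add: algebra_simps power2_eq_square)
    moreover have "disc3 a b (c + k * t + k\<^sup>2 * a) s (t + 2 * a * k) (v + k * s) = disc3 a b c s t v"
      by (simp add: disc3_def algebra_simps power2_eq_square)
    ultimately show thesis
      using k' 2 has_basis_form_moves(7)[of f a b c d s t u v w z k]
      by (intro that[of a b "c + k * t + k\<^sup>2 * a" d s "t + 2 * a * k" u "v + k * s" w "z + k * u"])
         (simp_all add: Min_def \<mu>_def)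
  qed
  obtain a b c d s t u v w z where 4: "Min a b c d s t u v w z" "\<bar>s\<bar> \<le> a"
    "2 * \<bar>2 * a * v - s * t\<bar> \<le> 4 * a * b - s\<^sup>2" "\<bar>t\<bar> \<le> a"
    "2 * \<bar>4*a*b*z - 2*a*v*w - s\<^sup>2*z + s*t*w + s*u*v - 2*b*t*u\<bar> \<le> disc3 a b c s t v"
  proof -
    obtain k where k: "2 * \<bar>4*a*b*z - 2*a*v*w - s\<^sup>2*z + s*t*w + s*u*v - 2*b*t*u
        + k * disc3 a b c s t v\<bar> \<le> disc3 a b c s t v"
      using ex_centered_residue MinD(4)[OF 3(1)] by blast
    have "4*a*b*(z + 2*c*k) - 2*a*v*(w + k*v) - s\<^sup>2*(z + 2*c*k) + s*t*(w + k*v) + s*(u + k*t)*v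
        - 2*b*t*(u + k*t)
      = 4*a*b*z - 2*a*v*w - s\<^sup>2*z + s*t*w + s*u*v - 2*b*t*u + k * disc3 a b c s t v"
      by (simp add: disc3_def algebra_simps power2_eq_square)
    then show thesis
      using k 3 has_basis_form_moves(8)[of f a b c d s t u v w z k]
      by (intro that[of a b c "d + k * z + k\<^sup>2 * c" s t "u + k * t" v "w + k * v" "z + 2 * c * k"])
         (simp_all add: Min_def)
  qed
  note rep = MinD(1)[OF 4(1)] and pos' = MinD(2-4)[OF 4(1)]
  have \<mu>: "\<mu> a b c s t v \<le> \<mu> a' b' c' s' t' v'" if "has_basis_form f a' b' c' d' s' t' u' v' w' z'"
    for a' b' c' d' s' t' u' v' w' z'
    using least[OF that] 4(1) by (simp add: Min_def)
  have "disc3 b a c s v t = disc3 a b c s t v" by (simp add: disc3_def algebra_simps)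
  moreover note \<mu>[OF has_basis_form_moves(1)[OF rep]]
  moreover note pos[OF has_basis_form_moves(1)[OF rep]]
  ultimately have "a * ((4 * a * b - s\<^sup>2) * disc3 a b c s t v) \<le> b * ((4 * a * b - s\<^sup>2) * disc3 a b c s t v)"
    using pos' by (simp add: \<mu>_def nat_le_eq_zle mult.commute mult.left_commute)
  then have 5: "a \<le> b" using pos' by (simp add: mult_le_cancel_right)
  have "disc3 a c b t s v = disc3 a b c s t v" by (simp add: disc3_def algebra_simps)
  moreover note \<mu>[OF has_basis_form_moves(2)[OF rep]]
  moreover note pos[OF has_basis_form_moves(2)[OF rep]]
  ultimately have "a * ((4 * a * b - s\<^sup>2) * disc3 a b c s t v) \<le> a * ((4 * a * c - t\<^sup>2) * disc3 a b c s t v)"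
    using pos' by (simp add: \<mu>_def nat_le_eq_zle)
  then have 6: "4 * a * b - s\<^sup>2 \<le> 4 * a * c - t\<^sup>2" using pos' by (simp add: mult_le_cancel_right)
  note \<mu>[OF has_basis_form_moves(3)[OF rep]]
  moreover note pos[OF has_basis_form_moves(3)[OF rep]]
  ultimately have "a * ((4 * a * b - s\<^sup>2) * disc3 a b c s t v) \<le> a * ((4 * a * b - s\<^sup>2) * disc3 a b d s u w)"
    using pos' by (simp add: \<mu>_def nat_le_eq_zle)
  then have 7: "disc3 a b c s t v \<le> disc3 a b d s u w" using pos' by (simp add: mult_le_cancel_left)
  show thesis by (rule that[OF rep 4(2,4,3,5) 5 6 7])
qed

section \<open>Class number one\<close>

text \<open>Let \<open>D1 = 2a, D2, D3\<close> be the leading minors. Sylvester's identity expresses \<open>D2 D2'\<close> and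
  \<open>D3 D3'\<close>, where the primed minors belong to the transposed bases, through the neighbouring minors and
  the square of an off-diagonal minor that size reduction bounds by half. This gives
  \<open>3 D1\<^sup>2 \<le> 4 D2\<close>, \<open>3 D2\<^sup>2 \<le> 4 D1 D3\<close> and \<open>3 D3\<^sup>2 \<le> 52 D2\<close>, which leave only the smallest values:
  the first three basis vectors are roots.\<close>

lemma reduced_bounds:
  fixes a b c d s t u v w z :: int
  defines "m \<equiv> 2*a*v - s*t" and "m' \<equiv> 4*a*b*z - 2*a*v*w - s\<^sup>2*z + s*t*w + s*u*v - 2*b*t*u"
  assumes det: "disc4 a b c d s t u v w z = 13"
    and pos: "a > 0" "4*a*b - s\<^sup>2 > 0" "disc3 a b c s t v > 0"
    and red: "\<bar>s\<bar> \<le> a" "\<bar>t\<bar> \<le> a" "2 * \<bar>m\<bar> \<le> 4*a*b - s\<^sup>2" "2 * \<bar>m'\<bar> \<le> disc3 a b c s t v"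
    and mono: "a \<le> b" "4*a*b - s\<^sup>2 \<le> 4*a*c - t\<^sup>2" "disc3 a b c s t v \<le> disc3 a b d s u w"
  shows "a = 1" "b = 1" "c = 1" "\<bar>s\<bar> \<le> 1" "\<bar>t\<bar> \<le> 1" "\<bar>v\<bar> \<le> 1"
proof -
  define D2 D2' D3 D3' where "D2 = 4*a*b - s\<^sup>2" and "D2' = 4*a*c - t\<^sup>2"
    and "D3 = disc3 a b c s t v" and "D3' = disc3 a b d s u w"
  note D = D2_def D2'_def D3_def D3'_def
  have id3: "D2 * D2' = 2*a*D3 + m\<^sup>2"
    unfolding D m_def disc3_def by (simp add: algebra_simps power2_eq_square)
  have id4: "D3 * D3' = 13 * D2 + m'\<^sup>2"
    unfolding det[symmetric] D m'_def disc3_def disc4_def by (simp add: algebra_simps power2_eq_square)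
  have sq: "4 * x\<^sup>2 \<le> y\<^sup>2" if "2 * \<bar>x\<bar> \<le> y" for x y :: int
    using power_mono[OF that, of 2] by (simp add: power_mult_distrib)
  have A: "3 * D2\<^sup>2 \<le> 8*a*D3"
  proof -
    have "D2\<^sup>2 \<le> D2 * D2'"
      unfolding power2_eq_square using mono pos by (intro mult_left_mono) (auto simp: D)
    then show ?thesis using id3 sq[OF red(3)] by (simp add: D2_def[symmetric])
  qed
  have B: "3 * D3\<^sup>2 \<le> 52*D2"
  proof -
    have "D3\<^sup>2 \<le> D3 * D3'"
      unfolding power2_eq_square using mono pos by (intro mult_left_mono) (auto simp: D)
    then show ?thesis using id4 sq[OF red(4)] by (simp add: D3_def[symmetric])
  qed
  have C: "3 * a\<^sup>2 \<le> D2"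
  proof -
    have "a\<^sup>2 \<le> a * b" unfolding power2_eq_square using mono pos by (intro mult_left_mono) auto
    moreover have "s\<^sup>2 \<le> a\<^sup>2" using red(1) power2_le_iff_abs_le pos by (metis less_le)
    ultimately show ?thesis unfolding D by linarith
  qed
  have D2: "D2 > 0" and D3: "D3 > 0" using pos by (simp_all add: D)
  have "D2 \<le> 6"
  proof -
    have "(3 * D2\<^sup>2)\<^sup>2 \<le> (8*a*D3)\<^sup>2" using A by (intro power_mono) auto
    then have "27 * (D2\<^sup>2 * D2\<^sup>2) \<le> 64 * (a\<^sup>2 * (3 * D3\<^sup>2))" by (simp add: algebra_simps power2_eq_square)
    also have "\<dots> \<le> 64 * (a\<^sup>2 * (52 * D2))" using B by (intro mult_left_mono) auto
    finally have "81 * (D2\<^sup>2 * D2\<^sup>2) \<le> 64 * ((3 * a\<^sup>2) * (52 * D2))" by (simp add: algebra_simps)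
    also have "\<dots> \<le> 64 * (D2 * (52 * D2))" using C D2 by (intro mult_left_mono mult_right_mono) auto
    also have "\<dots> = 3328 * D2\<^sup>2" by (simp add: power2_eq_square)
    finally have "D2\<^sup>2 * (81 * D2\<^sup>2) \<le> D2\<^sup>2 * 3328" by (simp add: algebra_simps)
    then have "81 * D2\<^sup>2 \<le> 3328" using D2 by (simp add: mult_le_cancel_left)
    then have "D2\<^sup>2 < 7\<^sup>2" by simp
    then show ?thesis using power_less_imp_less_base[of D2 2 7] by simp
  qed
  then have "a\<^sup>2 < 2\<^sup>2" using C by simp
  then have "a < 2" using power_less_imp_less_base[of a 2 2] by simp
  then show a: "a = 1" using pos(1) by simp
  then show s: "\<bar>s\<bar> \<le> 1" and t: "\<bar>t\<bar> \<le> 1" using red by simp_all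
  have s2: "s\<^sup>2 = 0 \<or> s\<^sup>2 = 1" and t2: "t\<^sup>2 = 0 \<or> t\<^sup>2 = 1"
    using s t by (auto simp: abs_le_iff power2_eq_1_iff)
  show b: "b = 1" using \<open>D2 \<le> 6\<close> mono(1) s2 a by (auto simp: D)
  have D2_cases: "D2 = 3 \<or> D2 = 4" using s2 a b by (auto simp: D)
  have "D3\<^sup>2 < 9\<^sup>2" using B D2_cases by auto
  then have D3_le: "D3 \<le> 8" using power_less_imp_less_base[of D3 2 9] by simp
  have "\<bar>m\<bar> \<le> 2" using red(3) D2_cases by (auto simp: D)
  then have "m\<^sup>2 \<le> 2\<^sup>2" using power_mono[of "\<bar>m\<bar>" 2 2] by simp
  then have "D2 * D2' \<le> 20" using id3 a D3_le by simp
  then have "D2' \<le> 6" using D2_cases by auto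
  then have "c < 2" using a t2 by (auto simp: D)
  moreover have "c > 0" using mono(2) pos(2) a t2 by auto
  ultimately show "c = 1" by simp
  have "\<bar>2 * v\<bar> \<le> \<bar>m\<bar> + \<bar>s * t\<bar>" using a by (simp add: m_def)
  also have "\<bar>s * t\<bar> \<le> 1 * 1" unfolding abs_mult using s t by (intro mult_mono) auto
  finally show "\<bar>v\<bar> \<le> 1" using \<open>\<bar>m\<bar> \<le> 2\<close> by linarith
qed

lemma square_mod_3: "(x::int)\<^sup>2 mod 3 = 0 \<or> x\<^sup>2 mod 3 = 1"
proof -
  have "x mod 3 = 0 \<or> x mod 3 = 1 \<or> x mod 3 = 2" by presburger
  then show ?thesis by (auto simp: power2_eq_square mod_mult_eq[of x 3 x, symmetric])
qed

text \<open>Three roots spanning \<open>A2 + A1\<close> cannot extend to a lattice of determinant \<open>13\<close>: modulo \<open>3\<close> the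
  determinant would force a square to be congruent to \<open>2\<close>.\<close>

lemma no_disc_13_over_A2_A1:
  fixes s :: int
  assumes "s = 1 \<or> s = - 1"
  shows "disc4 1 1 1 d s 0 u 0 w z \<noteq> 13"
proof
  assume "disc4 1 1 1 d s 0 u 0 w z = 13"
  then have "12 * d - 4 * (u\<^sup>2 - s * u * w + w\<^sup>2) - 3 * z\<^sup>2 = 13"
    using assms by (auto simp: disc4_def algebra_simps)
  moreover have "u\<^sup>2 - s * u * w + w\<^sup>2 = (u + s * w)\<^sup>2 - 3 * s * u * w"
    using assms by (auto simp: algebra_simps power2_eq_square)
  ultimately have "(u + s * w)\<^sup>2 = 3 * (4 * d + s * u * w * 4 - z\<^sup>2 - (u + s * w)\<^sup>2 - 5) + 2"
    by (simp add: algebra_simps)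
  then have "(u + s * w)\<^sup>2 mod 3 = 2" by presburger
  then show False using square_mod_3[of "u + s * w"] by simp
qed


lemma has_basis_form_negate:
  assumes "has_basis_form f a b c d s t u v w z"
  shows "has_basis_form f a b c d s (- t) u (- v) w (- z)"
    and "has_basis_form f a b c d s t (- u) v (- w) (- z)"
proof -
  have neg3: "has_basis_form f a b c d s (- t) u (- v) w (- z)"
    if "has_basis_form f a b c d s t u v w z" for a b c d s t u v w z
    using that by (intro has_basis_form_moves(2)[OF has_basis_form_moves(1)[OF has_basis_form_moves(4)
      [OF has_basis_form_moves(1)[OF has_basis_form_moves(2)]]], simplified])
  show "has_basis_form f a b c d s (- t) u (- v) w (- z)" using assms by (rule neg3)
  show "has_basis_form f a b c d s t (- u) v (- w) (- z)"
    using assms by (intro has_basis_form_moves(3)[OF neg3[OF has_basis_form_moves(3)]])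
qed

lemma has_basis_form_chain_signs:
  assumes "has_basis_form f 1 1 1 d s 0 u v w z" "s \<in> {-1, 1}" "v \<in> {-1, 1}"
  shows "\<exists>d u w z. has_basis_form f 1 1 1 d 1 0 u 1 w z"
proof -
  have "\<exists>u. has_basis_form f 1 1 1 d 1 0 u v w z"
    using assms(1,2) has_basis_form_moves(4)[OF assms(1)] by auto
  then obtain u where u: "has_basis_form f 1 1 1 d 1 0 u v w z" by blast
  have "has_basis_form f 1 1 1 d 1 0 u 1 w z \<or> has_basis_form f 1 1 1 d 1 0 u 1 w (- z)"
    using assms(3) u has_basis_form_negate(1)[OF u] by auto
  then show ?thesis by blast
qed

text \<open>Three roots span \<open>3 A1\<close>, \<open>A2 + A1\<close> or \<open>A3\<close>. The first two are excluded by the determinant,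
  modulo \<open>2\<close> and modulo \<open>3\<close>; the last one has a basis of roots forming a Dynkin chain.\<close>

lemma has_basis_form_A3_chain:
  assumes f: "pos_form13 f" and rep: "has_basis_form f 1 1 1 d s t u v w z"
    and st: "\<bar>s\<bar> \<le> 1" "\<bar>t\<bar> \<le> 1" "\<bar>v\<bar> \<le> 1"
  shows "\<exists>d u w z. has_basis_form f 1 1 1 d 1 0 u 1 w z"
proof -
  note pos_form13 = pos_form13_qform[OF has_basis_form_pos_form13[OF f]]
  have st': "s \<in> {-1, 0, 1}" "t \<in> {-1, 0, 1}" "v \<in> {-1, 0, 1}" using st by auto
  have not_A2_A1: False if "has_basis_form f 1 1 1 d s 0 u 0 w z" "s \<in> {-1, 1}" for d s u w z
    using that(2) pos_form13(1)[OF that(1)] no_disc_13_over_A2_A1 by auto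
  have not_3A1: False if "has_basis_form f 1 1 1 d 0 0 u 0 w z" for d u w z
  proof -
    have "16 * d - 4 * u\<^sup>2 - 4 * w\<^sup>2 - 4 * z\<^sup>2 = 13"
      using pos_form13(1)[OF that] by (simp add: disc4_def algebra_simps)
    then show False by presburger
  qed
  have pos: "8 + 2 * s * t * v - 2 * v\<^sup>2 - 2 * t\<^sup>2 - 2 * s\<^sup>2 > 0"
    using pos_form13(4)[OF rep] by (simp add: disc3_def)
  consider (none) "s = 0" "t = 0" "v = 0" | (s) "s \<in> {-1, 1}" "t = 0" "v = 0"
    | (t) "s = 0" "t \<in> {-1, 1}" "v = 0" | (v) "s = 0" "t = 0" "v \<in> {-1, 1}"
    | (sv) "s \<in> {-1, 1}" "t = 0" "v \<in> {-1, 1}" | (st) "s \<in> {-1, 1}" "t \<in> {-1, 1}" "v = 0"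
    | (tv) "s = 0" "t \<in> {-1, 1}" "v \<in> {-1, 1}" | (stv) "s \<in> {-1, 1}" "v \<in> {-1, 1}" "t = s * v"
    using st' pos by (elim insertE emptyE) simp_all
  then show ?thesis
  proof cases
    case none then show ?thesis using rep not_3A1 by blast
  next
    case s then show ?thesis using rep not_A2_A1 by blast
  next
    case t then show ?thesis using has_basis_form_moves(2)[OF rep] not_A2_A1 by blast
  next
    case v then show ?thesis using has_basis_form_moves(2)[OF has_basis_form_moves(1)[OF rep]] not_A2_A1 by blast
  next
    case sv then show ?thesis using rep has_basis_form_chain_signs by blast
  next
    case st then show ?thesis using has_basis_form_moves(1)[OF rep] has_basis_form_chain_signs by blast
  next
    case tv then show ?thesis using has_basis_form_moves(2)[OF rep] has_basis_form_chain_signs by blast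
  next
    case stv
    \<comment> \<open>subtracting \<open>v\<close> times the second root from the third one opens the triangle to a chain\<close>
    have "has_basis_form f 1 1 1 d s 0 u (- v) w (z - v * w)"
      using has_basis_form_moves(6)[OF rep, of "- v"] stv by (auto simp: power2_eq_square)
    from has_basis_form_chain_signs[OF this] show ?thesis using stv by auto
  qed
qed

text \<open>Only the class of the fourth vector in the cyclic group \<open>A3* / A3\<close> of order \<open>4\<close> matters, up to
  sign. Adding root vectors makes it orthogonal to the first two roots and reduces its product with
  the third one modulo \<open>4\<close>; determinant \<open>13\<close> selects the generators of the group.\<close>

lemma has_basis_form_glue:
  assumes f: "pos_form13 f" and rep: "has_basis_form f 1 1 1 d 1 0 u 1 w z"
  shows "has_basis_form f 1 1 1 2 1 0 0 1 0 1"
proof -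
  have 1: "\<exists>d w z. has_basis_form f 1 1 1 d 1 0 0 1 w z"
    using has_basis_form_moves(9)[OF rep, of "- u"] by auto
  then obtain d w z where r1: "has_basis_form f 1 1 1 d 1 0 0 1 w z" by blast
  have "\<exists>d z. has_basis_form f 1 1 1 d 1 0 0 1 0 z"
    using has_basis_form_moves(8)[OF r1, of "- w"] by auto
  then obtain d z where r2: "has_basis_form f 1 1 1 d 1 0 0 1 0 z" by blast
  \<comment> \<open>\<open>e1 - 2 e2 + 3 e3\<close> is orthogonal to \<open>e1\<close> and \<open>e2\<close>, and its product with \<open>e3\<close> is \<open>4\<close>\<close>
  have "\<exists>d. has_basis_form f 1 1 1 d 1 0 0 1 0 (z - 4 * k)" for k
    using has_basis_form_moves(10)[OF has_basis_form_moves(9)[OF has_basis_form_moves(8)[OF r2, of "- 3 * k"], of "2 * k"], of "- k"]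
    by (auto simp: algebra_simps)
  from this[of "(z + 1) div 4"] obtain d z where r3: "has_basis_form f 1 1 1 d 1 0 0 1 0 z"
    and z: "z \<in> {-1, 0, 1, 2}"
  proof -
    assume a: thesis if "has_basis_form f 1 1 1 d 1 0 0 1 0 z" "z \<in> {-1, 0, 1, 2}" for d z
    have "z - 4 * ((z + 1) div 4) \<in> {-1, 0, 1, 2}" by (simp, presburger)
    then show thesis using a \<open>\<exists>d. has_basis_form f 1 1 1 d 1 0 0 1 0 (z - 4 * ((z + 1) div 4))\<close> by blast
  qed
  have "8 * d = 13 + 3 * z\<^sup>2"
    using pos_form13_qform(1)[OF has_basis_form_pos_form13[OF f r3]] by (simp add: disc4_def)
  then have "d = 2" "z = 1 \<or> z = - 1" using z by (elim insertE emptyE; simp; presburger)+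
  then show ?thesis using r3 has_basis_form_negate(2)[OF r3] by auto
qed

lemma Q_eq_qform: "Q = qform 1 2 1 1 0 1 1 0 1 0"
  by (auto simp: Q_def qform_def)

text \<open>The \<open>A3\<close> chain with its glue vector is \<open>Q\<close> up to the order of the basis.\<close>

theorem class_number_one:
  assumes f: "pos_form13 f"
  shows "\<exists>\<phi>. unimod \<phi> \<and> f \<circ> \<phi> = Q"
proof -
  obtain a b c d s t u v w z where rep: "has_basis_form f a b c d s t u v w z" and red:
    "\<bar>s\<bar> \<le> a" "\<bar>t\<bar> \<le> a" "2 * \<bar>2 * a * v - s * t\<bar> \<le> 4 * a * b - s\<^sup>2"
    "2 * \<bar>4*a*b*z - 2*a*v*w - s\<^sup>2*z + s*t*w + s*u*v - 2*b*t*u\<bar> \<le> disc3 a b c s t v"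
    "a \<le> b" "4 * a * b - s\<^sup>2 \<le> 4 * a * c - t\<^sup>2" "disc3 a b c s t v \<le> disc3 a b d s u w"
    using f by (rule reduced_form_exists)
  note bounds = reduced_bounds[OF pos_form13_qform[OF has_basis_form_pos_form13[OF f rep]] red]
  obtain d u w z where "has_basis_form f 1 1 1 d 1 0 u 1 w z"
    using has_basis_form_A3_chain[OF f _ bounds(4-6)] rep bounds(1-3) by metis
  from has_basis_form_glue[OF f this] have r: "has_basis_form f 1 1 1 2 1 0 0 1 0 1" .
  have "has_basis_form f 1 2 1 1 0 1 1 0 1 0"
    using has_basis_form_moves(2)[OF has_basis_form_moves(3)[OF has_basis_form_moves(1)[OF r]]] .
  then show ?thesis unfolding has_basis_form_def Q_eq_qform .
qed

section \<open>Neighbours of the lattice\<close>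

definition polar :: "(vec \<Rightarrow> int) \<Rightarrow> vec \<Rightarrow> vec \<Rightarrow> int" where
  "polar f x y = f (x + y) - f x - f y"

definition vdvd :: "int \<Rightarrow> vec \<Rightarrow> bool" where
  "vdvd p x \<longleftrightarrow> (\<exists>y. x = smul p y)"

lemma vdvd_iff: "vdvd p (x1, x2, x3, x4) \<longleftrightarrow> p dvd x1 \<and> p dvd x2 \<and> p dvd x3 \<and> p dvd x4"
  by (auto simp: vdvd_def smul_def dvd_def split: prod.split)

lemma smul_simps:
  "smul k (x + y) = smul k x + smul k y" "smul k (x - y) = smul k x - smul k y"
  "smul (k + l) x = smul k x + smul l x" "smul (k - l) x = smul k x - smul l x"
  "smul k (smul l x) = smul (k * l) x" "smul 1 x = x" "smul 0 x = 0" "smul k 0 = 0" "smul (- k) x = - smul k x"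
  by (auto simp: smul_def algebra_simps zero_prod_def split: prod.splits)

lemma smul_inject: "k \<noteq> 0 \<Longrightarrow> smul k x = smul k y \<longleftrightarrow> x = y"
  by (auto simp: smul_def split: prod.splits)

lemma vdvd_smul_self: "vdvd p (smul p x)" and vdvd_0: "vdvd p 0"
  by (auto simp: vdvd_def) (metis smul_simps(8))

lemma vdvd_add: "vdvd p x \<Longrightarrow> vdvd p y \<Longrightarrow> vdvd p (x + y)"
  and vdvd_diff: "vdvd p x \<Longrightarrow> vdvd p y \<Longrightarrow> vdvd p (x - y)"
  and vdvd_smul: "vdvd p x \<Longrightarrow> vdvd p (smul k x)"
  unfolding vdvd_def by (metis smul_simps(1), metis smul_simps(2), metis smul_simps(5) mult.commute)

lemma vdvd_smul_dvd: "p dvd k \<Longrightarrow> vdvd p (smul k x)"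
  unfolding vdvd_def by (metis smul_simps(5) dvd_def)

lemma vdvd_unimod: "unimod \<phi> \<Longrightarrow> vdvd p (\<phi> x) \<longleftrightarrow> vdvd p x"
  unfolding vdvd_def by (metis unimod_inverse unimod_linear(2))

lemma polar_qform:
  "polar (qform a b c d s t u v w z) (x1, x2, x3, x4) (y1, y2, y3, y4) =
     (2*a*x1 + s*x2 + t*x3 + u*x4) * y1 + (s*x1 + 2*b*x2 + v*x3 + w*x4) * y2
     + (t*x1 + v*x2 + 2*c*x3 + z*x4) * y3 + (u*x1 + w*x2 + z*x3 + 2*d*x4) * y4"
  by (simp add: polar_def qform_def algebra_simps power2_eq_square)

lemma quadratic_laws:
  assumes "quadratic f"
  shows "f (smul k x) = k\<^sup>2 * f x"
    "polar f x y = polar f y x" "polar f x (y + y') = polar f x y + polar f x y'"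
    "polar f x (smul k y) = k * polar f x y" "polar f x (y - y') = polar f x y - polar f x y'"
proof -
  obtain a b c d s t u v w z where f: "f = qform a b c d s t u v w z"
    using assms unfolding quadratic_def by blast
  obtain x1 x2 x3 x4 y1 y2 y3 y4 z1 z2 z3 z4
    where xyz: "x = (x1, x2, x3, x4)" "y = (y1, y2, y3, y4)" "y' = (z1, z2, z3, z4)"
    by (cases x, cases y, cases y') blast
  note simps = f xyz polar_qform smul_def
  show "f (smul k x) = k\<^sup>2 * f x"
    unfolding simps by (simp add: qform_def algebra_simps power2_eq_square)
  show "polar f x y = polar f y x" unfolding simps by (simp add: algebra_simps)
  show "polar f x (y + y') = polar f x y + polar f x y'" unfolding simps by (simp add: polar_qform algebra_simps)
  show "polar f x (smul k y) = k * polar f x y" unfolding simps by (simp add: polar_qform algebra_simps)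
  show "polar f x (y - y') = polar f x y - polar f x y'" unfolding simps by (simp add: polar_qform algebra_simps)
qed

lemma polar_unimod: "unimod \<phi> \<Longrightarrow> polar (f \<circ> \<phi>) x y = polar f (\<phi> x) (\<phi> y)"
  by (simp add: polar_def unimod_linear)

lemma polar_dvd:
  assumes "quadratic f" "vdvd p y"
  shows "p dvd polar f x y" "p dvd polar f y x"
proof -
  show "p dvd polar f x y" using assms by (auto simp: vdvd_def quadratic_laws(4))
  then show "p dvd polar f y x" using quadratic_laws(2)[OF assms(1)] by metis
qed

text \<open>Finiteness and the number of vectors of each norm are inherited from \<open>Q\<close> by class number one.\<close>

lemma card_level_set:
  assumes "pos_form13 f"
  shows "card {x. f x = n} = card {x. Q x = n}" "finite {x. f x = n}"
proof -
  obtain \<phi> where \<phi>: "unimod \<phi>" "f \<circ> \<phi> = Q" using class_number_one[OF assms] by blast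
  have im: "\<phi> ` {x. Q x = n} = {x. f x = n}"
    using unimod_bij[OF \<phi>(1)] unfolding \<phi>(2)[symmetric]
    by (auto simp: image_iff) (metis bij_pointE)
  have inj: "inj_on \<phi> {x. Q x = n}" using unimod_bij[OF \<phi>(1)] by (meson bij_def inj_on_subset subset_UNIV)
  show "card {x. f x = n} = card {x. Q x = n}" using card_image[OF inj] im by simp
  have "{x. Q x = n} = {} \<or> {x. Q x = n} = {x. Q x = int (nat n)}"
  proof (cases "n \<ge> 0")
    case False
    have "Q x \<ge> 0" for x
    proof (cases x)
      case (fields x1 x2 x3 x4)
      have "0 \<le> 24 * Q x" unfolding fields Q_sum_of_squares by simp
      then show ?thesis by simp
    qed
    then show ?thesis using False by (metis (mono_tags, lifting) Collect_empty_eq)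
  qed simp
  then have "finite {x. Q x = n}" using finite_Q_eq by (metis finite.emptyI)
  then show "finite {x. f x = n}" unfolding im[symmetric] by simp
qed

text \<open>The vectors \<open>z = p x\<close> for those \<open>x\<close> of norm \<open>n\<close> in the neighbour at \<open>y\<close> that lie outside \<open>L\<close>. For
  \<open>z\<close> on the line of \<open>y\<close> modulo \<open>p\<close> but not in \<open>p L\<close>, the congruence \<open>Q(z) \<equiv> 0 (mod p\<^sup>2)\<close> already
  characterises membership in the neighbour, so that no lift of \<open>y\<close> has to be chosen.\<close>

definition new_part :: "(vec \<Rightarrow> int) \<Rightarrow> int \<Rightarrow> vec \<Rightarrow> int \<Rightarrow> vec set" where
  "new_part f p y n = {z. f z = p\<^sup>2 * n \<and> \<not> vdvd p z \<and> (\<exists>t. vdvd p (z - smul t y))}"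

text \<open>The vectors of norm \<open>n\<close> common to \<open>L\<close> and its neighbour at \<open>y\<close>.\<close>

definition old_part :: "(vec \<Rightarrow> int) \<Rightarrow> int \<Rightarrow> vec \<Rightarrow> int \<Rightarrow> vec set" where
  "old_part f p y n = {w. f w = n \<and> p dvd polar f y w}"

definition nbr_count :: "(vec \<Rightarrow> int) \<Rightarrow> int \<Rightarrow> vec \<Rightarrow> int \<Rightarrow> nat" where
  "nbr_count f p y n = card (new_part f p y n) + card (old_part f p y n)"

lemma card_vimage_bij: "bij \<phi> \<Longrightarrow> card (\<phi> -` A) = card A"
  by (rule bij_betw_same_card[of \<phi>]) (auto simp: bij_betw_def bij_def inj_on_def surj_def image_iff)

lemma nbr_count_unimod:
  assumes "unimod \<phi>"
  shows "nbr_count (f \<circ> \<phi>) p y n = nbr_count f p (\<phi> y) n"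
proof -
  have "vdvd p (z - smul t y) \<longleftrightarrow> vdvd p (\<phi> z - smul t (\<phi> y))" for z t
    using vdvd_unimod[OF assms, of p "z - smul t y"] by (simp add: unimod_diff[OF assms] unimod_linear[OF assms])
  then have "new_part (f \<circ> \<phi>) p y n = \<phi> -` new_part f p (\<phi> y) n"
    by (auto simp: new_part_def vdvd_unimod[OF assms])
  moreover have "old_part (f \<circ> \<phi>) p y n = \<phi> -` old_part f p (\<phi> y) n"
    by (auto simp: old_part_def polar_unimod[OF assms])
  ultimately show ?thesis unfolding nbr_count_def by (simp add: card_vimage_bij unimod_bij[OF assms])
qed

lemma ex_mod_inverse:
  fixes p t :: int
  assumes "prime p" "\<not> p dvd t"
  obtains k where "p dvd k * t - 1" "\<not> p dvd k"
proof -
  have "coprime t p" using assms prime_imp_coprime[of p t] by (simp add: coprime_commute)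
  then obtain k where k: "[t * k = 1] (mod p)" using cong_solve_coprime_int by blast
  then have d: "p dvd k * t - 1" by (simp add: cong_iff_dvd_diff mult.commute)
  moreover have "\<not> p dvd k"
  proof
    assume "p dvd k"
    then have "p dvd k * t - (k * t - 1)" using d by (meson dvd_diff dvd_mult2)
    then have "p dvd 1" by simp
    then show False using assms(1) not_prime_unit by blast
  qed
  ultimately show thesis by (rule that)
qed

lemma line_sym:
  assumes "prime p" "vdvd p (y' - smul t y)" "\<not> p dvd t"
  obtains k where "vdvd p (y - smul k y')" "\<not> p dvd k"
proof -
  obtain k where k: "p dvd k * t - 1" "\<not> p dvd k" using ex_mod_inverse assms by blast
  have "y - smul k y' = - smul (k * t - 1) y - smul k (y' - smul t y)"
    by (simp add: smul_simps)
  moreover have "vdvd p (- smul (k * t - 1) y)"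
    using vdvd_smul_dvd[OF k(1)] vdvd_diff[OF vdvd_0] by (metis diff_0)
  ultimately show thesis using that k(2) vdvd_diff vdvd_smul assms(2) by metis
qed

text \<open>A neighbour depends only on the line spanned by \<open>y\<close> modulo \<open>p\<close>.\<close>

lemma nbr_count_line:
  assumes p: "prime p" and f: "quadratic f" and y: "vdvd p (y' - smul t y)" "\<not> p dvd t"
  shows "nbr_count f p y' n = nbr_count f p y n"
proof -
  have incl: "new_part f p y' n \<subseteq> new_part f p y n \<and> old_part f p y n \<subseteq> old_part f p y' n"
    if "vdvd p (y' - smul t y)" for y y' t
  proof
    have "vdvd p (z - smul (k * t) y)" if "vdvd p (z - smul k y')" for z k
    proof -
      have "z - smul (k * t) y = (z - smul k y') + smul k (y' - smul t y)"
        by (simp add: smul_simps)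
      then show ?thesis using that \<open>vdvd p (y' - smul t y)\<close> vdvd_add vdvd_smul by metis
    qed
    then show "new_part f p y' n \<subseteq> new_part f p y n" unfolding new_part_def by blast
    have "p dvd polar f y' w" if "p dvd polar f y w" for w
    proof -
      have "polar f y' w = polar f w (y' - smul t y) + t * polar f y w"
        using quadratic_laws[OF f] by (simp add: quadratic_laws(2)[OF f, of _ w])
      then show ?thesis using that polar_dvd(1)[OF f \<open>vdvd p (y' - smul t y)\<close>] by simp
    qed
    then show "old_part f p y n \<subseteq> old_part f p y' n" unfolding old_part_def by blast
  qed
  obtain k where "vdvd p (y - smul k y')" using line_sym[OF p y] by blast
  from incl[OF this] incl[OF y(1)] show ?thesis unfolding nbr_count_def by (metis subset_antisym)
qed

text \<open>After scaling modulo \<open>p\<close>, some coordinate of \<open>y\<close> is \<open>1\<close>, and a vector with a coordinate \<open>1\<close> is part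
  of an obvious basis of \<open>\<int>\<^sup>4\<close>.\<close>

lemma primitive_to_e1:
  assumes p: "prime p" and y: "\<not> vdvd p y"
  obtains \<phi> t where "unimod \<phi>" "\<not> p dvd t" "vdvd p (\<phi> (1, 0, 0, 0) - smul t y)"
proof -
  note result = that
  have first: "\<exists>\<phi> t. unimod \<phi> \<and> \<not> p dvd t \<and> vdvd p (\<phi> (1, 0, 0, 0) - smul t (y1, y2, y3, y4))"
    if y1: "\<not> p dvd y1" for y1 y2 y3 y4
  proof -
    obtain t where t: "p dvd t * y1 - 1" "\<not> p dvd t" using ex_mod_inverse[OF p y1] by blast
    define \<phi> where "\<phi> = (\<lambda>(x1, x2, x3, x4). (x1, x2 + (t * y2) * x1, x3, x4)) \<circ>
      ((\<lambda>(x1, x2, x3, x4). (x1, x2, x3 + (t * y3) * x1, x4)) \<circ> (\<lambda>(x1, x2, x3, x4). (x1, x2, x3, x4 + (t * y4) * x1)) :: vec \<Rightarrow> vec)"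
    have "unimod \<phi>" unfolding \<phi>_def by (intro unimod_comp unimod_shears)
    moreover have "vdvd p (\<phi> (1, 0, 0, 0) - smul t (y1, y2, y3, y4))"
      using t(1) by (simp add: \<phi>_def smul_def vdvd_iff zero_prod_def dvd_diff_commute)
    ultimately show ?thesis using t(2) by blast
  qed
  have transport: thesis if \<sigma>: "unimod \<sigma>" "\<And>x. \<sigma> (\<sigma> x) = x" and y: "\<sigma> y = (z1, z2, z3, z4)" "\<not> p dvd z1"
    for \<sigma> z1 z2 z3 z4
  proof -
    obtain \<phi> t where \<phi>: "unimod \<phi>" "\<not> p dvd t" "vdvd p (\<phi> (1, 0, 0, 0) - smul t (\<sigma> y))"
      using first[OF y(2)] y(1) by metis
    have "(\<sigma> \<circ> \<phi>) (1, 0, 0, 0) - smul t y = \<sigma> (\<phi> (1, 0, 0, 0) - smul t (\<sigma> y))"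
      using \<sigma> by (simp add: unimod_diff unimod_linear)
    then have "vdvd p ((\<sigma> \<circ> \<phi>) (1, 0, 0, 0) - smul t y)" using \<phi>(3) vdvd_unimod[OF \<sigma>(1)] by metis
    then show thesis using result unimod_comp[OF \<sigma>(1) \<phi>(1)] \<phi>(2) by blast
  qed
  obtain y1 y2 y3 y4 where yy: "y = (y1, y2, y3, y4)" by (cases y)
  consider "\<not> p dvd y1" | "\<not> p dvd y2" | "\<not> p dvd y3" | "\<not> p dvd y4" using y yy vdvd_iff by blast
  then show thesis
  proof cases
    case 1 then show ?thesis using transport[OF unimod_id] yy by blast
  next
    case 2 then show ?thesis using transport[OF unimod_gens(1)] yy by (simp add: generator_defs split_def)
  next
    case 3 then show ?thesis using transport[OF unimod_swaps(1)] yy by (simp add: split_def)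
  next
    case 4 then show ?thesis using transport[OF unimod_swaps(2)] yy by (simp add: split_def)
  qed
qed

text \<open>In these coordinates the neighbour at the first basis vector has the basis
  \<open>e1/p, p e2, e3, e4\<close>, and dividing the form by the appropriate powers of \<open>p\<close> keeps it integral with
  the same determinant. By class number one the neighbour is counted by \<open>Q\<close>.\<close>

lemma nbr_count_adapted:
  assumes p: "prime p" and f: "pos_form13 (qform (p\<^sup>2 * a) b c d s (p * t) (p * u) v w z)" and s: "\<not> p dvd s"
  shows "nbr_count (qform (p\<^sup>2 * a) b c d s (p * t) (p * u) v w z) p (1, 0, 0, 0) n = card {x. Q x = n}"
proof -
  let ?f = "qform (p\<^sup>2 * a) b c d s (p * t) (p * u) v w z"
  \<comment> \<open>the form on the neighbour; \<open>\<phi>\<close> sends coordinates in the basis \<open>e1/p, p e2, e3, e4\<close> to \<open>p\<close> times the vector\<close>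
  define g where "g = qform a (p\<^sup>2 * b) c d s t u (p * v) (p * w) z"
  define \<phi> :: "vec \<Rightarrow> vec" where "\<phi> = (\<lambda>(x1, x2, x3, x4). (x1, p\<^sup>2 * x2, p * x3, p * x4))"
  have p0: "p \<noteq> 0" using p by auto
  have f\<phi>: "?f (\<phi> x) = p\<^sup>2 * g x" for x
    by (cases x) (simp add: g_def \<phi>_def qform_def algebra_simps power2_eq_square)
  have inj: "inj \<phi>" using p0 by (auto simp: inj_def \<phi>_def)
  have "pos_form13 g"
    unfolding g_def
  proof (rule pos_form13I[OF refl])
    show "disc4 a (p\<^sup>2 * b) c d s t u (p * v) (p * w) z = 13"
      unfolding pos_form13_qform(1)[OF f, symmetric] disc4_def by (simp add: algebra_simps power2_eq_square)
    fix x :: vec assume "x \<noteq> 0"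
    then have "\<phi> x \<noteq> 0" using p0 by (cases x) (auto simp: \<phi>_def zero_prod_def)
    then have "p\<^sup>2 * g x > 0" using f f\<phi> unfolding pos_form13_def by metis
    then show "qform a (p\<^sup>2 * b) c d s t u (p * v) (p * w) z x > 0"
      using p0 by (simp add: g_def zero_less_mult_iff)
  qed
  let ?N = "new_part ?f p (1, 0, 0, 0) n" and ?O = "old_part ?f p (1, 0, 0, 0) n"
  have polar: "polar ?f (1, 0, 0, 0) (x1, x2, x3, x4) = s * x2 + p * (2 * p * a * x1 + t * x3 + u * x4)"
    for x1 x2 x3 x4
    by (simp add: polar_qform algebra_simps power2_eq_square)
  have f_smul: "?f (smul p x) = p\<^sup>2 * ?f x" for x
    using quadratic_laws(1)[OF pos_form13_quadratic[OF f]] .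
  have "\<phi> ` {x. g x = n} = ?N \<union> smul p ` ?O"
  proof (intro equalityI subsetI)
    fix y assume "y \<in> \<phi> ` {x. g x = n}"
    then obtain x1 x2 x3 x4 where y: "y = \<phi> (x1, x2, x3, x4)" and g: "g (x1, x2, x3, x4) = n" by auto
    have fy: "?f y = p\<^sup>2 * n" using f\<phi> g y by metis
    show "y \<in> ?N \<union> smul p ` ?O"
    proof (cases "p dvd x1")
      case True
      then obtain k where k: "x1 = p * k" by blast
      define w' where "w' = (k, p * x2, x3, x4)"
      have yw: "y = smul p w'" by (simp add: y k w'_def \<phi>_def smul_def power2_eq_square)
      then have "?f w' = n" using fy f_smul p0 by simp
      moreover have "p dvd polar ?f (1, 0, 0, 0) w'" unfolding w'_def polar by simp
      ultimately show ?thesis using yw unfolding old_part_def by blast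
    next
      case False
      then have "\<not> vdvd p y" by (simp add: y \<phi>_def vdvd_iff)
      moreover have "vdvd p (y - smul x1 (1, 0, 0, 0))"
        by (simp add: y \<phi>_def smul_def vdvd_iff power2_eq_square)
      ultimately show ?thesis using fy unfolding new_part_def by blast
    qed
  next
    fix y assume "y \<in> ?N \<union> smul p ` ?O"
    then show "y \<in> \<phi> ` {x. g x = n}"
    proof
      assume y: "y \<in> ?N"
      obtain y1 y2 y3 y4 where yy: "y = (y1, y2, y3, y4)" by (cases y)
      from y obtain k where "vdvd p (y - smul k (1, 0, 0, 0))" unfolding new_part_def by blast
      then obtain x2 x3 x4 where x: "y2 = p * x2" "y3 = p * x3" "y4 = p * x4"
        by (auto simp: yy smul_def vdvd_iff elim!: dvdE)
      have "\<not> p dvd y1" using y by (auto simp: new_part_def yy vdvd_iff x)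
      have "?f y = p * (s * y1 * x2 + p * (a * y1\<^sup>2 + b * x2\<^sup>2 + c * x3\<^sup>2 + d * x4\<^sup>2 + t * y1 * x3
          + u * y1 * x4 + v * x2 * x3 + w * x2 * x4 + z * x3 * x4))"
        by (simp add: yy x qform_def algebra_simps power2_eq_square)
      moreover have "?f y = p * (p * n)" using y by (simp add: new_part_def power2_eq_square)
      ultimately have "s * y1 * x2 + p * (a * y1\<^sup>2 + b * x2\<^sup>2 + c * x3\<^sup>2 + d * x4\<^sup>2 + t * y1 * x3
          + u * y1 * x4 + v * x2 * x3 + w * x2 * x4 + z * x3 * x4) = p * n"
        using p0 by (metis mult_left_cancel)
      then have "p dvd s * y1 * x2" by (metis dvd_triv_left dvd_add_left_iff)
      then have "p dvd x2" using s \<open>\<not> p dvd y1\<close> p by (simp add: prime_dvd_mult_iff)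
      then obtain k where "x2 = p * k" by blast
      then have "y = \<phi> (y1, k, x3, x4)" by (simp add: yy x \<phi>_def power2_eq_square)
      moreover have "?f y = p\<^sup>2 * n" using y by (simp add: new_part_def)
      ultimately show ?thesis using f\<phi>[of "(y1, k, x3, x4)"] p0 by auto
    next
      assume "y \<in> smul p ` ?O"
      then obtain x1 x2 x3 x4 where y: "y = smul p (x1, x2, x3, x4)"
        and x: "?f (x1, x2, x3, x4) = n" "p dvd polar ?f (1, 0, 0, 0) (x1, x2, x3, x4)"
        unfolding old_part_def by auto
      have "p dvd s * x2" using x(2) unfolding polar by (metis dvd_triv_left dvd_add_left_iff)
      then have "p dvd x2" using s p by (simp add: prime_dvd_mult_iff)
      then obtain k where "x2 = p * k" by blast
      then have "y = \<phi> (p * x1, k, x3, x4)" by (simp add: y \<phi>_def smul_def power2_eq_square)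
      moreover have "?f y = p\<^sup>2 * n" using x(1) f_smul y by metis
      ultimately show ?thesis using f\<phi>[of "(p * x1, k, x3, x4)"] p0 by auto
    qed
  qed
  then have "card {x. g x = n} = card (?N \<union> smul p ` ?O)"
    using card_image[of \<phi> "{x. g x = n}"] inj by (metis inj_on_subset subset_UNIV)
  also have "\<dots> = card ?N + card (smul p ` ?O)"
  proof (rule card_Un_disjoint)
    show "finite ?N"
      using card_level_set(2)[OF f, of "p\<^sup>2 * n"] by (elim finite_subset[rotated]) (auto simp: new_part_def)
    show "finite (smul p ` ?O)"
      using card_level_set(2)[OF f, of n] by (intro finite_imageI, elim finite_subset[rotated]) (auto simp: old_part_def)
    show "?N \<inter> smul p ` ?O = {}" using vdvd_smul_self by (auto simp: new_part_def)
  qed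
  also have "card (smul p ` ?O) = card ?O"
    using smul_inject[OF p0] by (intro card_image) (auto simp: inj_on_def)
  finally show ?thesis unfolding nbr_count_def using card_level_set(1)[OF \<open>pos_form13 g\<close>] by simp
qed

lemma dvd_solve:
  fixes p s t :: int
  assumes "prime p" "\<not> p dvd s"
  obtains k where "p dvd t + k * s"
proof -
  obtain k where "p dvd k * s - 1" using ex_mod_inverse assms by blast
  then have "p dvd (- t) * (k * s - 1)" by (rule dvd_mult)
  then have "p dvd t + (- t * k) * s" by (simp add: algebra_simps)
  then show thesis by (rule that)
qed


text \<open>Shears of the third and fourth vector by the second make them orthogonal to the first modulo \<open>p\<close>;
  moving the first vector by a multiple of \<open>p e2\<close> then lifts the isotropy from \<open>p\<close> to \<open>p\<^sup>2\<close>. The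
  invertible coefficient \<open>s\<close> solves all three congruences.\<close>

lemma nbr_count_isotropic_e1:
  assumes p: "prime p" and f: "pos_form13 (qform a b c d s t u v w z)" and a: "p dvd a" and s: "\<not> p dvd s"
  shows "nbr_count (qform a b c d s t u v w z) p (1, 0, 0, 0) n = card {x. Q x = n}"
proof -
  let ?f = "qform a b c d s t u v w z" and ?e = "(1, 0, 0, 0) :: vec"
  obtain k where k: "p dvd t + k * s" using dvd_solve p s by blast
  obtain l where l: "p dvd u + l * s" using dvd_solve p s by blast
  obtain a0 where a0: "a = p * a0" using a by blast
  obtain m where m: "p dvd a0 + m * s" using dvd_solve p s by blast
  define \<psi>1 :: "vec \<Rightarrow> vec" where "\<psi>1 = (\<lambda>(x1, x2, x3, x4). (x1, x2 + k * x3, x3, x4))"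
  define \<psi>2 :: "vec \<Rightarrow> vec" where "\<psi>2 = (\<lambda>(x1, x2, x3, x4). (x1, x2 + l * x4, x3, x4))"
  define \<psi>3 :: "vec \<Rightarrow> vec" where "\<psi>3 = (\<lambda>(x1, x2, x3, x4). (x1, x2 + (p * m) * x1, x3, x4))"
  note \<psi>_defs = \<psi>1_def \<psi>2_def \<psi>3_def
  define \<psi> where "\<psi> = \<psi>1 \<circ> (\<psi>2 \<circ> \<psi>3)"
  have \<psi>: "unimod \<psi>" unfolding \<psi>_def \<psi>_defs by (intro unimod_comp unimod_shears)
  obtain a1 where a1: "a0 + m * s = p * a1" using m by blast
  obtain t1 where t1: "t + k * s = p * t1" using k by blast
  obtain u1 where u1: "u + l * s = p * u1" using l by blast
  define v1 w1 where "v1 = v + 2 * b * k" and "w1 = w + 2 * b * l"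
  have f\<psi>: "?f \<circ> \<psi> = qform (p\<^sup>2 * (a1 + m\<^sup>2 * b)) b (c + k * v + k\<^sup>2 * b) (d + l * w + l\<^sup>2 * b)
      (s + 2 * b * (p * m)) (p * (t1 + m * v1)) (p * (u1 + m * w1)) v1 w1 (z + k * w + l * v1)"
  proof -
    have "?f \<circ> \<psi> = qform (a + (p * m) * s + (p * m)\<^sup>2 * b) b (c + k * v + k\<^sup>2 * b) (d + l * w + l\<^sup>2 * b)
      (s + 2 * b * (p * m)) (t + k * s + (p * m) * v1) (u + l * s + (p * m) * w1) v1 w1 (z + k * w + l * v1)"
      by (auto simp: \<psi>_def \<psi>_defs v1_def w1_def qform_def algebra_simps power2_eq_square)
    moreover have "a + (p * m) * s + (p * m)\<^sup>2 * b = p\<^sup>2 * (a1 + m\<^sup>2 * b)"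
    proof -
      have "a + (p * m) * s + (p * m)\<^sup>2 * b = p * (a0 + m * s) + p\<^sup>2 * m\<^sup>2 * b"
        by (simp add: a0 algebra_simps power2_eq_square)
      then show ?thesis unfolding a1 by (simp add: algebra_simps power2_eq_square)
    qed
    moreover have "t + k * s + (p * m) * v1 = p * (t1 + m * v1)" "u + l * s + (p * m) * w1 = p * (u1 + m * w1)"
      unfolding t1 u1 by (simp_all add: algebra_simps)
    ultimately show ?thesis by (simp only:)
  qed
  have "\<not> p dvd s + 2 * b * (p * m)" using s by (simp add: dvd_add_left_iff)
  then have "nbr_count (?f \<circ> \<psi>) p ?e n = card {x. Q x = n}"
    unfolding f\<psi> using nbr_count_adapted[OF p] pos_form13_unimod[OF \<psi> f] f\<psi> by metis
  moreover have "vdvd p (\<psi> ?e - smul 1 ?e)" by (simp add: \<psi>_def \<psi>_defs smul_def vdvd_iff zero_prod_def)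
  moreover have "\<not> p dvd 1" using p not_prime_unit by blast
  ultimately show ?thesis
    using nbr_count_unimod[OF \<psi>, of ?f] nbr_count_line[OF p pos_form13_quadratic[OF f]] by metis
qed

text \<open>The neighbour at an isotropic \<open>y\<close> outside the radical contains as many vectors of each norm as the
  lattice itself. Moving \<open>y\<close> to the first basis vector reduces this to the adapted coordinates: one of
  the products of \<open>e1\<close> with the other basis vectors is prime to \<open>p\<close>, and it can be moved into second
  position.\<close>

theorem nbr_count_eq:
  assumes p: "prime p" and f: "pos_form13 f" and y: "p dvd f y" "\<not> p dvd polar f y x"
  shows "nbr_count f p y n = card {x. Q x = n}"
proof -
  let ?e = "(1, 0, 0, 0) :: vec"
  note quad = pos_form13_quadratic[OF f]
  have "\<not> vdvd p y" using y(2) polar_dvd[OF quad] by blast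
  then obtain \<phi> t0 where \<phi>: "unimod \<phi>" "\<not> p dvd t0" "vdvd p (\<phi> ?e - smul t0 y)"
    using primitive_to_e1[OF p] by blast
  define g where "g = f \<circ> \<phi>"
  have g: "pos_form13 g" unfolding g_def using pos_form13_unimod[OF \<phi>(1) f] .
  have count: "nbr_count f p y n = nbr_count g p ?e n"
    unfolding g_def nbr_count_unimod[OF \<phi>(1)] using nbr_count_line[OF p quad \<phi>(3,2)] by simp
  have fe: "p dvd g ?e \<and> (\<exists>x. \<not> p dvd polar g ?e x)"
  proof -
    obtain k where "\<phi> ?e - smul t0 y = smul p k" using \<phi>(3) unfolding vdvd_def by blast
    then have k: "\<phi> ?e = smul t0 y + smul p k" by (metis add.commute diff_add_cancel)
    have "f (\<phi> ?e) = f (smul t0 y) + f (smul p k) + polar f (smul t0 y) (smul p k)"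
      unfolding k by (simp add: polar_def)
    then have "p dvd g ?e"
      using y(1) by (simp add: g_def quadratic_laws[OF quad] power2_eq_square)
    moreover obtain x' where x': "\<phi> x' = x" using unimod_inverse[OF \<phi>(1)] by blast
    have "polar g ?e x' = t0 * polar f y x + p * polar f x k"
      unfolding g_def polar_unimod[OF \<phi>(1)] x' k
      by (simp add: quadratic_laws(3,4)[OF quad] quadratic_laws(2)[OF quad, of _ x])
    then have "\<not> p dvd polar g ?e x'"
      using y(2) \<phi>(2) p by (simp add: dvd_add_left_iff prime_dvd_mult_iff)
    ultimately show ?thesis by blast
  qed
  obtain a b c d s t u v w z where gq: "g = qform a b c d s t u v w z" using g by (rule pos_form13E)
  have a: "p dvd a" using fe by (simp add: gq qform_def)
  have "\<not> (p dvd s \<and> p dvd t \<and> p dvd u)"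
    using fe a by (auto simp: gq polar_qform split_paired_Ex)
  then consider "\<not> p dvd s" | "\<not> p dvd t" | "\<not> p dvd u" by blast
  then have "nbr_count g p ?e n = card {x. Q x = n}"
  proof cases
    case 1
    then show ?thesis using nbr_count_isotropic_e1[OF p _ a] g gq by metis
  next
    case 2
    have "g \<circ> swap23 = qform a c b d t s u v z w"
      unfolding gq by (auto simp: qform_def generator_defs algebra_simps)
    then have "nbr_count (g \<circ> swap23) p ?e n = card {x. Q x = n}"
      using nbr_count_isotropic_e1[OF p _ a 2] pos_form13_gens(2)[OF g] by metis
    then show ?thesis using nbr_count_unimod[OF unimod_gens(2)] by (simp add: generator_defs)
  next
    case 3
    let ?\<sigma> = "(\<lambda>(x1, x2, x3, x4). (x1, x4, x3, x2)) :: vec \<Rightarrow> vec"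
    have "g \<circ> ?\<sigma> = qform a d c b u t s z w v"
      unfolding gq by (auto simp: qform_def algebra_simps)
    then have "nbr_count (g \<circ> ?\<sigma>) p ?e n = card {x. Q x = n}"
      using nbr_count_isotropic_e1[OF p _ a 3] pos_form13_unimod[OF unimod_swaps(3) g] by metis
    then show ?thesis using nbr_count_unimod[OF unimod_swaps(3)] by simp
  qed
  then show ?thesis using count by simp
qed

section \<open>Residue classes and the neighbour identity\<close>

definition box :: "int \<Rightarrow> vec set" where
  "box p = {0..<p} \<times> {0..<p} \<times> {0..<p} \<times> {0..<p}"

definition reduce_mod :: "int \<Rightarrow> vec \<Rightarrow> vec" where
  "reduce_mod p = (\<lambda>(x1, x2, x3, x4). (x1 mod p, x2 mod p, x3 mod p, x4 mod p))"

lemma finite_box: "finite (box p)" by (simp add: box_def)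

lemma reduce_mod_in_box: "p > 0 \<Longrightarrow> reduce_mod p x \<in> box p"
  by (auto simp: reduce_mod_def box_def split: prod.split)

lemma vdvd_reduce_mod: "vdvd p (reduce_mod p x - x)" "vdvd p (x - reduce_mod p x)"
  by (auto simp: reduce_mod_def vdvd_iff mod_eq_dvd_iff[symmetric] split: prod.split)

lemma reduce_mod_eqI: "vdvd p (x - y) \<Longrightarrow> reduce_mod p x = reduce_mod p y"
  by (auto simp: reduce_mod_def vdvd_iff mod_eq_dvd_iff split: prod.splits)

lemma reduce_mod_box: "x \<in> box p \<Longrightarrow> reduce_mod p x = x"
  by (auto simp: reduce_mod_def box_def)

definition periodic :: "int \<Rightarrow> vec set \<Rightarrow> bool" where
  "periodic p S \<longleftrightarrow> (\<forall>x y. vdvd p (x - y) \<longrightarrow> x \<in> S \<longrightarrow> y \<in> S)"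

definition residue_count :: "int \<Rightarrow> vec set \<Rightarrow> nat" where
  "residue_count p S = card (S \<inter> box p)"

text \<open>A unimodular substitution permutes the residue classes modulo \<open>p\<close>.\<close>

lemma residue_count_unimod:
  assumes "p > 0" "unimod \<phi>" "periodic p S"
  shows "residue_count p (\<phi> -` S) = residue_count p S"
  unfolding residue_count_def
proof (rule bij_betw_same_card)
  obtain \<psi> where \<psi>: "unimod \<psi>" "\<And>x. \<phi> (\<psi> x) = x" "\<And>x. \<psi> (\<phi> x) = x"
    using unimod_inverse[OF assms(2)] by blast
  have cancel: "reduce_mod p (\<beta> (reduce_mod p (\<alpha> x))) = reduce_mod p x" if "\<And>x. \<beta> (\<alpha> x) = x" "unimod \<beta>" for \<alpha> \<beta> x
  proof (rule reduce_mod_eqI)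
    have "\<beta> (reduce_mod p (\<alpha> x)) - x = \<beta> (reduce_mod p (\<alpha> x) - \<alpha> x)" using that by (simp add: unimod_diff)
    then show "vdvd p (\<beta> (reduce_mod p (\<alpha> x)) - x)" using vdvd_unimod[OF that(2)] vdvd_reduce_mod by metis
  qed
  have S: "reduce_mod p x \<in> S \<longleftrightarrow> x \<in> S" for x
    using assms(3) vdvd_reduce_mod unfolding periodic_def by metis
  show "bij_betw (\<lambda>x. reduce_mod p (\<phi> x)) (\<phi> -` S \<inter> box p) (S \<inter> box p)"
  proof (rule bij_betw_byWitness[where f' = "\<lambda>x. reduce_mod p (\<psi> x)"])
    show "\<forall>x\<in>\<phi> -` S \<inter> box p. reduce_mod p (\<psi> (reduce_mod p (\<phi> x))) = x"
      using cancel[of \<psi> \<phi>] \<psi> reduce_mod_box by simp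
    show "\<forall>x\<in>S \<inter> box p. reduce_mod p (\<phi> (reduce_mod p (\<psi> x))) = x"
      using cancel[of \<phi> \<psi>] \<psi> assms(2) reduce_mod_box by simp
    show "(\<lambda>x. reduce_mod p (\<phi> x)) ` (\<phi> -` S \<inter> box p) \<subseteq> S \<inter> box p"
      using S reduce_mod_in_box[OF assms(1)] by blast
    have "\<phi> (reduce_mod p (\<psi> x)) \<in> S" if "x \<in> S" for x
    proof -
      have "reduce_mod p (\<phi> (reduce_mod p (\<psi> x))) = reduce_mod p x" using cancel[of \<phi> \<psi>] \<psi> assms(2) by simp
      then show ?thesis using S that by metis
    qed
    then show "(\<lambda>x. reduce_mod p (\<psi> x)) ` (S \<inter> box p) \<subseteq> \<phi> -` S \<inter> box p"
      using reduce_mod_in_box[OF assms(1)] by blast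
  qed
qed

lemma quadratic_dvd_cong:
  assumes "quadratic f" "vdvd p (x - y)"
  shows "p dvd f x \<longleftrightarrow> p dvd f y" "p dvd polar f x w \<longleftrightarrow> p dvd polar f y w"
    "p dvd polar f w x \<longleftrightarrow> p dvd polar f w y"
proof -
  obtain k where k: "x - y = smul p k" using assms(2) unfolding vdvd_def by blast
  then have x: "x = y + smul p k" by (metis add.commute diff_add_cancel)
  have "f x = f y + p\<^sup>2 * f k + p * polar f y k"
    unfolding x using quadratic_laws(1)[OF assms(1), of p k] quadratic_laws(4)[OF assms(1), of y p k]
    by (simp add: polar_def[of f y "smul p k"])
  then have "f x = f y + p * (p * f k + polar f y k)" by (simp add: algebra_simps power2_eq_square)
  then show "p dvd f x \<longleftrightarrow> p dvd f y" by (simp add: dvd_add_left_iff)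
  have "polar f w x = polar f w y + p * polar f w k"
    unfolding x using quadratic_laws(3,4)[OF assms(1)] by simp
  then show *: "p dvd polar f w x \<longleftrightarrow> p dvd polar f w y" by (simp add: dvd_add_left_iff)
  then show "p dvd polar f x w \<longleftrightarrow> p dvd polar f y w" using quadratic_laws(2)[OF assms(1)] by metis
qed

lemma pos_form13_Q: "pos_form13 Q"
proof (rule pos_form13I[OF Q_eq_qform])
  show "disc4 1 2 1 1 0 1 1 0 1 0 = 13" by (simp add: disc4_def)
  fix x :: vec assume "x \<noteq> 0"
  obtain x1 x2 x3 x4 where x: "x = (x1, x2, x3, x4)" by (cases x)
  have "24 * Q x \<noteq> 0"
  proof
    assume "24 * Q x = 0"
    then have "6 * (2 * x1 + x3 + x4)\<^sup>2 = 0 \<and> 3 * (4 * x2 + x4)\<^sup>2 = 0 \<and> 2 * (3 * x3 - x4)\<^sup>2 = 0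
        \<and> 13 * x4\<^sup>2 = 0"
      unfolding x Q_sum_of_squares
      using zero_le_power2[of "2 * x1 + x3 + x4"] zero_le_power2[of "4 * x2 + x4"]
        zero_le_power2[of "3 * x3 - x4"] zero_le_power2[of x4] by linarith
    then show False using \<open>x \<noteq> 0\<close> x by (auto simp: zero_prod_def)
  qed
  moreover have "24 * Q x \<ge> 0" unfolding x Q_sum_of_squares by simp
  ultimately show "Q x > 0" by linarith
qed

lemmas quadratic_Q = pos_form13_quadratic[OF pos_form13_Q]

definition nonradical :: "int \<Rightarrow> vec \<Rightarrow> bool" where
  "nonradical p y \<longleftrightarrow> (\<exists>x. \<not> p dvd polar Q y x)"

lemma nonradical_cong: "vdvd p (x - y) \<Longrightarrow> nonradical p x \<longleftrightarrow> nonradical p y"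
  unfolding nonradical_def using quadratic_dvd_cong(2)[OF quadratic_Q] by metis

lemma nonradical_not_vdvd: "nonradical p x \<Longrightarrow> \<not> vdvd p x"
  unfolding nonradical_def using polar_dvd[OF quadratic_Q] by blast

lemma nonradical_smul:
  "prime p \<Longrightarrow> nonradical p (smul k x) \<longleftrightarrow> \<not> p dvd k \<and> nonradical p x"
  by (auto simp: nonradical_def quadratic_laws(2)[OF quadratic_Q, of "smul k x"]
      quadratic_laws(4)[OF quadratic_Q] quadratic_laws(2)[OF quadratic_Q, of x] prime_dvd_mult_iff)

text \<open>Representatives of the nonradical isotropic vectors modulo \<open>p\<close>. Each neighbour is indexed by the
  \<open>p - 1\<close> vectors on its line, which avoids choosing one of them.\<close>

definition cone :: "int \<Rightarrow> vec set" where
  "cone p = {y \<in> box p. p dvd Q y \<and> nonradical p y}"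

lemma finite_cone: "finite (cone p)"
  using finite_box by (rule finite_subset[rotated]) (auto simp: cone_def)

lemma card_cone_on_line:
  assumes p: "prime p" and z: "p dvd Q z" "nonradical p z"
  shows "card {y \<in> cone p. \<exists>t. vdvd p (z - smul t y)} = nat (p - 1)"
proof -
  have p0: "p > 0" using p prime_gt_0_int by blast
  define h where "h k = reduce_mod p (smul k z)" for k
  have h: "vdvd p (h k - smul k z)" "vdvd p (smul k z - h k)" for k unfolding h_def by (rule vdvd_reduce_mod)+
  have "{y \<in> cone p. \<exists>t. vdvd p (z - smul t y)} = h ` {1..<p}"
  proof (intro equalityI subsetI)
    fix y assume y: "y \<in> {y \<in> cone p. \<exists>t. vdvd p (z - smul t y)}"
    then obtain t where t: "vdvd p (z - smul t y)" by blast
    have "\<not> p dvd t"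
    proof
      assume "p dvd t"
      then have "vdvd p (smul t y)" by (rule vdvd_smul_dvd)
      with t have "vdvd p (z - smul t y + smul t y)" by (rule vdvd_add)
      then show False using nonradical_not_vdvd[OF z(2)] by simp
    qed
    then obtain k where k: "vdvd p (y - smul k z)" "\<not> p dvd k" using line_sym[OF p t] by blast
    have "vdvd p (smul k z - smul (k mod p) z)"
      unfolding smul_simps(4)[symmetric] by (rule vdvd_smul_dvd) (simp add: minus_mod_eq_mult_div)
    with k(1) have "vdvd p ((y - smul k z) + (smul k z - smul (k mod p) z))" by (rule vdvd_add)
    then have "reduce_mod p y = h (k mod p)" unfolding h_def by (intro reduce_mod_eqI) simp
    moreover have "reduce_mod p y = y" using y reduce_mod_box by (auto simp: cone_def)
    moreover have "k mod p \<in> {1..<p}"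
      using k(2) pos_mod_sign[OF p0, of k] pos_mod_bound[OF p0, of k]
      by (auto simp: dvd_eq_mod_eq_0 order_le_less)
    ultimately show "y \<in> h ` {1..<p}" by (metis imageI)
  next
    fix y assume "y \<in> h ` {1..<p}"
    then obtain k where k: "k \<in> {1..<p}" and y: "y = h k" by blast
    have kp: "\<not> p dvd k" using k zdvd_not_zless by auto
    have "y \<in> cone p"
      unfolding cone_def
    proof (intro CollectI conjI)
      show "y \<in> box p" unfolding y h_def using reduce_mod_in_box[OF p0] .
      have "p dvd Q (smul k z)" using z(1) quadratic_laws(1)[OF quadratic_Q] by simp
      then show "p dvd Q y" using quadratic_dvd_cong(1)[OF quadratic_Q h(1)] y by simp
      show "nonradical p y"
        using nonradical_cong[OF h(1)] nonradical_smul[OF p] kp z(2) y by simp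
    qed
    moreover have "\<exists>t. vdvd p (z - smul t y)" using line_sym[OF p h(1) kp] y by metis
    ultimately show "y \<in> {y \<in> cone p. \<exists>t. vdvd p (z - smul t y)}" by blast
  qed
  moreover have "inj_on h {1..<p}"
  proof (rule inj_onI)
    fix k l assume kl: "k \<in> {1..<p}" "l \<in> {1..<p}" "h k = h l"
    have "vdvd p ((smul k z - h k) + (h l - smul l z))" using h by (intro vdvd_add)
    then have "vdvd p (smul (k - l) z)" using kl(3) by (simp add: smul_simps)
    then have "p dvd k - l" using nonradical_smul[OF p] nonradical_not_vdvd z(2) by metis
    then have "k mod p = l mod p" by (simp add: mod_eq_dvd_iff)
    then show "k = l" using kl by simp
  qed
  ultimately show ?thesis by (simp add: card_image)
qed

text \<open>Double counting of the pairs consisting of an element \<open>y\<close> of the cone and a vector of norm \<open>n\<close> in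
  the neighbour at \<open>y\<close>. Each \<open>z\<close> of norm \<open>p\<^sup>2 n\<close> that is nonradical modulo \<open>p\<close> arises from the \<open>p - 1\<close>
  vectors on its own line.\<close>

theorem neighbour_identity:
  assumes p: "prime p"
  shows "card (cone p) * card {w. Q w = n} =
    nat (p - 1) * card {z. Q z = p\<^sup>2 * n \<and> nonradical p z}
    + (\<Sum>w | Q w = n. card {y \<in> cone p. p dvd polar Q y w})"
proof -
  let ?Z = "{z. Q z = p\<^sup>2 * n \<and> nonradical p z}" and ?W = "{w. Q w = n}"
  have fin: "finite ?W" "finite ?Z"
    using card_level_set(2)[OF pos_form13_Q] by (auto intro: finite_subset[rotated])
  have new: "new_part Q p y n = {z \<in> ?Z. \<exists>t. vdvd p (z - smul t y)}" if "y \<in> cone p" for y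
  proof -
    have "nonradical p z \<longleftrightarrow> \<not> vdvd p z" if t: "vdvd p (z - smul t y)" for z t
    proof -
      have "vdvd p z" if "p dvd t"
        using vdvd_add[OF t vdvd_smul_dvd[OF that, of y]] by simp
      then show ?thesis
        using nonradical_cong[OF t] nonradical_smul[OF p, of t y] nonradical_not_vdvd[of p z] \<open>y \<in> cone p\<close>
        by (auto simp: cone_def)
    qed
    then show ?thesis unfolding new_part_def by blast
  qed
  have "card (cone p) * card ?W = (\<Sum>y\<in>cone p. nbr_count Q p y n)"
  proof -
    have "nbr_count Q p y n = card ?W" if "y \<in> cone p" for y
      using that nbr_count_eq[OF p pos_form13_Q, of y] unfolding cone_def nonradical_def by blast
    then show ?thesis by simp
  qed
  also have "\<dots> = (\<Sum>y\<in>cone p. card {z \<in> ?Z. \<exists>t. vdvd p (z - smul t y)})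
      + (\<Sum>y\<in>cone p. card {w \<in> ?W. p dvd polar Q y w})"
    unfolding nbr_count_def sum.distrib[symmetric]
    by (intro sum.cong refl) (simp add: new old_part_def)
  also have "(\<Sum>y\<in>cone p. card {z \<in> ?Z. \<exists>t. vdvd p (z - smul t y)})
      = (\<Sum>z\<in>?Z. card {y \<in> cone p. \<exists>t. vdvd p (z - smul t y)})"
    using sum.swap_restrict[OF finite_cone fin(2), of "\<lambda>_ _. 1::nat" "\<lambda>y z. \<exists>t. vdvd p (z - smul t y)"]
    by simp
  also have "\<dots> = (\<Sum>z\<in>?Z. nat (p - 1))"
    by (intro sum.cong refl card_cone_on_line[OF p]) (auto simp: power2_eq_square)
  also have "(\<Sum>y\<in>cone p. card {w \<in> ?W. p dvd polar Q y w})
      = (\<Sum>w\<in>?W. card {y \<in> cone p. p dvd polar Q y w})"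
    using sum.swap_restrict[OF finite_cone fin(1), of "\<lambda>_ _. 1::nat" "\<lambda>y w. p dvd polar Q y w"]
    by simp
  finally show ?thesis by simp
qed

section \<open>Zeros of ternary forms over a prime field\<close>

lemma inj_on_square_mod:
  fixes p k m :: int
  assumes p: "prime p" and k: "\<not> p dvd k"
  shows "inj_on (\<lambda>x. (k * x\<^sup>2 + m) mod p) {0..(p - 1) div 2}"
proof (rule inj_onI)
  fix x y assume xy: "x \<in> {0..(p - 1) div 2}" "y \<in> {0..(p - 1) div 2}"
    "(k * x\<^sup>2 + m) mod p = (k * y\<^sup>2 + m) mod p"
  then have "p dvd (k * x\<^sup>2 + m) - (k * y\<^sup>2 + m)" by (simp add: mod_eq_dvd_iff)
  then have "p dvd k * ((x - y) * (x + y))" by (simp add: algebra_simps power2_eq_square)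
  then have "p dvd x - y \<or> p dvd x + y" using p k by (simp add: prime_dvd_mult_iff)
  moreover have "\<bar>x - y\<bar> < p" "\<bar>x + y\<bar> < p" using xy prime_gt_0_int[OF p] by auto
  ultimately have "x - y = 0 \<or> x + y = 0"
    using dvd_imp_le_int[of "x - y" p] dvd_imp_le_int[of "x + y" p] by fastforce
  then show "x = y" using xy by auto
qed

text \<open>Both \<open>\<beta> x\<^sup>2\<close> and \<open>- y\<^sup>2 - \<delta>\<close> take \<open>(p + 1) / 2\<close> values modulo \<open>p\<close>, so they share one.\<close>

lemma conic_has_affine_point:
  fixes p \<beta> \<delta> :: int
  assumes p: "prime p" and odd: "odd p" and \<beta>: "\<not> p dvd \<beta>"
  obtains x y where "p dvd \<beta> * x\<^sup>2 + y\<^sup>2 + \<delta>"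
proof -
  let ?I = "{0..(p - 1) div 2}"
  define A where "A = (\<lambda>x. (\<beta> * x\<^sup>2 + 0) mod p) ` ?I"
  define B where "B = (\<lambda>y. (- 1 * y\<^sup>2 + - \<delta>) mod p) ` ?I"
  have p0: "p > 0" using prime_gt_0_int[OF p] .
  have "\<not> p dvd - 1" using p not_prime_unit by (metis dvd_minus_iff)
  then have card: "card A = nat ((p - 1) div 2 + 1)" "card B = nat ((p - 1) div 2 + 1)"
    unfolding A_def B_def
    using card_image[OF inj_on_square_mod[OF p \<beta>]] card_image[OF inj_on_square_mod[OF p \<open>\<not> p dvd - 1\<close>]]
    by (simp_all only: card_atLeastAtMost_int diff_0_right)
  have "A \<inter> B \<noteq> {}"
  proof
    assume "A \<inter> B = {}"
    then have "card A + card B = card (A \<union> B)" by (intro card_Un_disjoint[symmetric]) (simp_all add: A_def B_def)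
    also have "\<dots> \<le> card {0..<p}" using p0 by (intro card_mono) (auto simp: A_def B_def)
    finally have "nat ((p - 1) div 2 + 1) + nat ((p - 1) div 2 + 1) \<le> nat p" unfolding card by simp
    moreover obtain j where "p = 2 * j + 1" using odd by (elim oddE)
    ultimately show False using p0 by simp
  qed
  then obtain x y where "(\<beta> * x\<^sup>2 + 0) mod p = (- 1 * y\<^sup>2 + - \<delta>) mod p" unfolding A_def B_def by blast
  then have "p dvd (\<beta> * x\<^sup>2 + 0) - (- 1 * y\<^sup>2 + - \<delta>)" by (simp only: mod_eq_dvd_iff)
  then show thesis by (intro that[of x y]) (simp add: algebra_simps)
qed

text \<open>Completing squares turns the ternary form into a diagonal one, to which the pigeonhole argument
  above applies; if a coefficient vanishes on the way, it yields an isotropic vector at once.\<close>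

lemma ternary_isotropic:
  fixes p :: int
  assumes p: "prime p" and odd: "odd p"
  obtains x y t where "\<not> (p dvd x \<and> p dvd y \<and> p dvd t)"
    "p dvd b * x\<^sup>2 + c * y\<^sup>2 + d * t\<^sup>2 + v * x * y + w * x * t + z * y * t"
proof -
  have unit: "\<not> p dvd 1" using p not_prime_unit by blast
  have two: "\<not> p dvd 2"
  proof
    assume "p dvd 2"
    then have "p \<le> 2" by (rule zdvd_imp_le) simp
    then have "p = 2" using prime_gt_1_int[OF p] by simp
    then show False using odd by simp
  qed
  define \<beta> where "\<beta> = 4 * b * c - v\<^sup>2"
  define \<kappa> where "\<kappa> = 2 * b * z - v * w"
  define \<gamma> where "\<gamma> = 4 * b * d - w\<^sup>2"
  consider "p dvd b" | "\<not> p dvd b" "p dvd \<beta>" | "\<not> p dvd b" "\<not> p dvd \<beta>" by blast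
  then show thesis
  proof cases
    case 1
    then show ?thesis using unit by (intro that[of 1 0 0]) simp_all
  next
    case 2
    have "b * (- v)\<^sup>2 + c * (2 * b)\<^sup>2 + v * (- v) * (2 * b) = b * \<beta>"
      by (simp add: \<beta>_def algebra_simps power2_eq_square)
    then show ?thesis
      using 2 two p by (intro that[of "- v" "2 * b" 0]) (simp_all add: prime_dvd_mult_iff)
  next
    case 3
    obtain X Y where XY: "p dvd \<beta> * X\<^sup>2 + Y\<^sup>2 + (\<beta> * \<gamma> - \<kappa>\<^sup>2)"
      using conic_has_affine_point[OF p odd 3(2)] by blast
    obtain y where "p dvd (\<kappa> - Y) + y * \<beta>" using dvd_solve[OF p 3(2)] by blast
    then obtain m where "(\<kappa> - Y) + y * \<beta> = p * m" by blast
    then have m: "\<kappa> + y * \<beta> = Y + p * m" by simp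
    have "\<not> p dvd 2 * b" using 3 two p by (simp add: prime_dvd_mult_iff)
    then obtain x where "p dvd (v * y + w - X) + x * (2 * b)" using dvd_solve[OF p] by blast
    then obtain l where "(v * y + w - X) + x * (2 * b) = p * l" by blast
    then have l: "v * y + w + x * (2 * b) = X + p * l" by simp
    \<comment> \<open>\<open>x\<close> and \<open>y\<close> solve the two triangular equations that complete the squares, in the chart where the third coordinate is \<open>1\<close>\<close>
    let ?g = "b * x\<^sup>2 + c * y\<^sup>2 + d * 1\<^sup>2 + v * x * y + w * x * 1 + z * y * 1"
    have "4 * b * \<beta> * ?g = \<beta> * (v * y + w + x * (2 * b))\<^sup>2 + (\<kappa> + y * \<beta>)\<^sup>2 + (\<beta> * \<gamma> - \<kappa>\<^sup>2)"
      by (simp add: \<beta>_def \<kappa>_def \<gamma>_def algebra_simps power2_eq_square)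
    also have "\<dots> = (\<beta> * X\<^sup>2 + Y\<^sup>2 + (\<beta> * \<gamma> - \<kappa>\<^sup>2)) + p * (\<beta> * (2 * X * l + p * l\<^sup>2) + 2 * Y * m + p * m\<^sup>2)"
      unfolding l m by (simp add: algebra_simps power2_eq_square)
    finally have "4 * b * \<beta> * ?g = (\<beta> * X\<^sup>2 + Y\<^sup>2 + (\<beta> * \<gamma> - \<kappa>\<^sup>2))
      + p * (\<beta> * (2 * X * l + p * l\<^sup>2) + 2 * Y * m + p * m\<^sup>2)" .
    then have "p dvd 4 * b * \<beta> * ?g" using XY by (simp only: dvd_add dvd_triv_left)
    moreover have "4 * b * \<beta> * ?g = 2 * ((2 * b) * (\<beta> * ?g))" by simp
    ultimately have "p dvd ?g" using 3 two \<open>\<not> p dvd 2 * b\<close> prime_dvd_mult_iff[OF p] by metis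
    then show ?thesis using unit by (intro that[of x y 1]) simp_all
  qed
qed

text \<open>Ternary forms are treated as restrictions of quaternary ones to the hyperplane where the first
  coordinate vanishes modulo \<open>p\<close>, so that the substitutions above can be reused. The condition says
  that the restriction has trivial radical modulo \<open>p\<close>.\<close>

definition ternary_nondeg :: "int \<Rightarrow> (vec \<Rightarrow> int) \<Rightarrow> bool" where
  "ternary_nondeg p f \<longleftrightarrow>
     (\<forall>y. p dvd fst y \<longrightarrow> (\<forall>x. p dvd fst x \<longrightarrow> p dvd polar f y x) \<longrightarrow> vdvd p y)"

lemma ternary_nondegD:
  assumes "ternary_nondeg p f" "p dvd fst y" "\<And>x. p dvd fst x \<Longrightarrow> p dvd polar f y x"
  shows "vdvd p y"
  using assms unfolding ternary_nondeg_def by blast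

definition ternary_zeros :: "int \<Rightarrow> (vec \<Rightarrow> int) \<Rightarrow> vec set" where
  "ternary_zeros p f = {y. p dvd fst y \<and> p dvd f y}"

lemma ternary_unimod:
  assumes \<phi>: "unimod \<phi>" "\<And>x. fst (\<phi> x) = fst x"
  shows "ternary_nondeg p (f \<circ> \<phi>) \<longleftrightarrow> ternary_nondeg p f"
    and "quadratic f \<Longrightarrow> p > 0 \<Longrightarrow> residue_count p (ternary_zeros p (f \<circ> \<phi>)) = residue_count p (ternary_zeros p f)"
proof -
  obtain \<psi> where \<psi>: "unimod \<psi>" "\<And>x. \<phi> (\<psi> x) = x" "\<And>x. \<psi> (\<phi> x) = x"
    using unimod_inverse[OF \<phi>(1)] by blast
  have 1: "ternary_nondeg p (f \<circ> \<phi>)"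
    if nd: "ternary_nondeg p f" and \<phi>: "unimod \<phi>" "\<And>x. fst (\<phi> x) = fst x" "\<And>x. \<phi> (\<psi> x) = x" for f \<phi> \<psi>
    unfolding ternary_nondeg_def
  proof (intro allI impI)
    fix y assume y: "p dvd fst y" "\<forall>x. p dvd fst x \<longrightarrow> p dvd polar (f \<circ> \<phi>) y x"
    have "p dvd polar f (\<phi> y) x" if "p dvd fst x" for x
      using y(2)[rule_format, of "\<psi> x"] that \<phi>(2)[of "\<psi> x"] by (simp add: polar_unimod \<phi>)
    then have "vdvd p (\<phi> y)" using nd y(1) \<phi>(2) unfolding ternary_nondeg_def by metis
    then show "vdvd p y" using vdvd_unimod[OF \<phi>(1)] by blast
  qed
  have 2: "fst (\<psi> x) = fst x" for x using \<phi>(2)[of "\<psi> x"] \<psi> by simp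
  have "f \<circ> \<phi> \<circ> \<psi> = f" using \<psi> by auto
  then show "ternary_nondeg p (f \<circ> \<phi>) \<longleftrightarrow> ternary_nondeg p f"
    using 1[OF _ \<phi> \<psi>(2)] 1[of "f \<circ> \<phi>" \<psi> \<phi>, OF _ \<psi>(1) 2 \<psi>(3)] by metis
  assume f: "quadratic f" and p: "p > 0"
  have "periodic p (ternary_zeros p f)"
    unfolding periodic_def
  proof (intro allI impI)
    fix x y assume xy: "vdvd p (x - y)" "x \<in> ternary_zeros p f"
    have "p dvd fst x \<longleftrightarrow> p dvd fst y"
      using xy(1) by (cases x, cases y) (auto simp: vdvd_iff dvd_diff_left_iff dvd_diff_right_iff dest: dvd_diffD dvd_diffD1)
    then show "y \<in> ternary_zeros p f"
      using xy quadratic_dvd_cong(1)[OF f xy(1)] by (simp add: ternary_zeros_def)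
  qed
  then have "residue_count p (\<phi> -` ternary_zeros p f) = residue_count p (ternary_zeros p f)" by (rule residue_count_unimod[OF p \<phi>(1)])
  moreover have "\<phi> -` ternary_zeros p f = ternary_zeros p (f \<circ> \<phi>)"
    using \<phi>(2) unfolding ternary_zeros_def by auto
  ultimately show "residue_count p (ternary_zeros p (f \<circ> \<phi>)) = residue_count p (ternary_zeros p f)" by simp
qed

lemma card_linear_root:
  fixes p k m :: int
  assumes p: "prime p" and k: "\<not> p dvd k"
  shows "card {x \<in> {0..<p}. p dvd k * x + m} = 1"
proof -
  have p0: "p > 0" using prime_gt_0_int[OF p] .
  obtain x0 where x0: "p dvd m + x0 * k" using dvd_solve[OF p k] by blast
  have "{x \<in> {0..<p}. p dvd k * x + m} = {x0 mod p}"
  proof (intro equalityI subsetI)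
    fix x assume x: "x \<in> {x \<in> {0..<p}. p dvd k * x + m}"
    then have "p dvd (k * x + m) - (m + x0 * k)" using x0 by (intro dvd_diff) auto
    then have "p dvd k * (x - x0)" by (simp add: algebra_simps)
    then have "x mod p = x0 mod p" using p k by (simp add: prime_dvd_mult_iff mod_eq_dvd_iff)
    then show "x \<in> {x0 mod p}" using x by simp
  next
    fix x assume "x \<in> {x0 mod p}"
    then have x: "x = x0 mod p" by simp
    have "k * x + m = (m + x0 * k) - p * (k * (x0 div p))"
      unfolding x minus_mult_div_eq_mod[symmetric] by (simp add: algebra_simps)
    then have "p dvd k * x + m" by (simp only: dvd_diff[OF x0 dvd_triv_left])
    then show "x \<in> {x \<in> {0..<p}. p dvd k * x + m}" using p0 x by simp
  qed
  then show ?thesis by simp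
qed

text \<open>The equation reads \<open>v x2 x3 + c x3\<^sup>2 + z x3 x4 + d x4\<^sup>2 = 0\<close> over the prime field. For \<open>x3 \<noteq> 0\<close> it
  determines \<open>x2\<close>, and for \<open>x3 = 0\<close> it forces \<open>x4 = 0\<close> and leaves \<open>x2\<close> free: each value of \<open>x3\<close>
  contributes \<open>p\<close> solutions.\<close>

lemma ternary_count_normal_form:
  fixes p :: int
  assumes p: "prime p" and b: "p dvd b" and w: "p dvd w" and v: "\<not> p dvd v" and d: "\<not> p dvd d"
  shows "residue_count p (ternary_zeros p (qform a b c d s t u v w z)) = nat p ^ 2"
proof -
  let ?f = "qform a b c d s t u v w z"
  have p0: "p > 0" using prime_gt_0_int[OF p] .
  define F where "F x3 x4 = {x2 \<in> {0..<p}. p dvd v * x3 * x2 + (c * x3\<^sup>2 + d * x4\<^sup>2 + z * x3 * x4)}" for x3 x4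
  have eq: "p dvd ?f (0, x2, x3, x4) \<longleftrightarrow> p dvd v * x3 * x2 + (c * x3\<^sup>2 + d * x4\<^sup>2 + z * x3 * x4)" for x2 x3 x4
  proof -
    obtain b' w' where bw: "b = p * b'" "w = p * w'" using b w by blast
    have "?f (0, x2, x3, x4) = p * (b' * x2\<^sup>2 + w' * x2 * x4)
      + (v * x3 * x2 + (c * x3\<^sup>2 + d * x4\<^sup>2 + z * x3 * x4))"
      by (simp add: qform_def bw algebra_simps)
    then show ?thesis by (simp add: dvd_add_right_iff)
  qed
  have fst0: "p dvd x \<longleftrightarrow> x = 0" if "x \<in> {0..<p}" for x using that zdvd_not_zless[of x p] by force
  have "ternary_zeros p ?f \<inter> box p
      = (\<lambda>((x3, x4), x2). (0, x2, x3, x4)) ` (SIGMA (x3, x4) : {0..<p} \<times> {0..<p}. F x3 x4)"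
    using fst0 p0 by (auto simp: ternary_zeros_def box_def F_def eq image_iff Bex_def split_paired_Ex)
  moreover have "inj_on (\<lambda>((x3, x4), x2). (0::int, x2, x3, x4)) A" for A :: "((int \<times> int) \<times> int) set"
    by (auto simp: inj_on_def)
  ultimately have "residue_count p (ternary_zeros p ?f) = card (SIGMA (x3, x4) : {0..<p} \<times> {0..<p}. F x3 x4)"
    unfolding residue_count_def by (simp add: card_image)
  also have "\<dots> = (\<Sum>(x3, x4)\<in>{0..<p} \<times> {0..<p}. card (F x3 x4))"
  proof -
    have "finite (F x3 x4)" for x3 x4 unfolding F_def by (rule finite_subset[of _ "{0..<p}"]) auto
    then show ?thesis by (subst card_SigmaI) (auto simp: split_def)
  qed
  also have "\<dots> = (\<Sum>x3\<in>{0..<p}. \<Sum>x4\<in>{0..<p}. card (F x3 x4))"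
    by (simp add: sum.cartesian_product)
  also have "\<dots> = (\<Sum>x3\<in>{0..<p}. nat p)"
  proof (rule sum.cong[OF refl])
    fix x3 assume x3: "x3 \<in> {0..<p}"
    show "(\<Sum>x4\<in>{0..<p}. card (F x3 x4)) = nat p"
    proof (cases "x3 = 0")
      case True
      have "card (F x3 x4) = (if x4 = 0 then nat p else 0)" if "x4 \<in> {0..<p}" for x4
      proof -
        have "F x3 x4 = (if x4 = 0 then {0..<p} else {})"
          using fst0[OF that] d p by (auto simp: F_def True prime_dvd_mult_iff prime_dvd_power_iff)
        then show ?thesis by simp
      qed
      then have "(\<Sum>x4\<in>{0..<p}. card (F x3 x4)) = (\<Sum>x4\<in>{0..<p}. if x4 = 0 then nat p else 0)"
        by (intro sum.cong refl)
      then show ?thesis using p0 by simp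
    next
      case False
      then have "\<not> p dvd v * x3" using fst0[OF x3] v p by (simp add: prime_dvd_mult_iff)
      then show ?thesis unfolding F_def using card_linear_root[OF p] by simp
    qed
  qed
  finally show ?thesis using p0 by (simp add: power2_eq_square)
qed

text \<open>A nondegenerate ternary form has an isotropic vector, which is moved to the second basis vector;
  nondegeneracy then provides the remaining conditions of the normal form.\<close>

theorem ternary_count:
  fixes p :: int
  assumes p: "prime p" and odd: "odd p" and f: "quadratic f" and nd: "ternary_nondeg p f"
  shows "residue_count p (ternary_zeros p f) = nat p ^ 2"
proof -
  have p0: "p > 0" using prime_gt_0_int[OF p] .
  have unit: "\<not> p dvd 1" using p not_prime_unit by blast
  obtain a b c d s t u v w z where fq: "f = qform a b c d s t u v w z"
    using f unfolding quadratic_def by blast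
  let ?e2 = "(0, 1, 0, 0) :: vec"
  have isotropic_first: "residue_count p (ternary_zeros p g) = nat p ^ 2"
    if g: "g = qform a b c d s t u v w z" and nd: "ternary_nondeg p g" and b: "p dvd b" and v: "\<not> p dvd v"
    for g a b c d s t u v w z
  proof -
    obtain k where k: "p dvd w + k * v" using dvd_solve p v by blast
    define \<psi> where "\<psi> = (\<lambda>(x1, x2, x3, x4). (x1, x2, x3 + k * x4, x4) :: vec)"
    have \<psi>: "unimod \<psi>" "\<And>x. fst (\<psi> x) = fst x"
      unfolding \<psi>_def by (rule unimod_shears, simp add: split_def)
    define d' z' where "d' = d + k * z + k\<^sup>2 * c" and "z' = z + 2 * c * k"
    have g\<psi>: "g \<circ> \<psi> = qform a b c d' s t (u + k * t) v (w + k * v) z'"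
      unfolding g d'_def z'_def by (auto simp: \<psi>_def qform_def algebra_simps power2_eq_square)
    have "\<not> p dvd d'"
    proof
      assume d': "p dvd d'"
      \<comment> \<open>a vanishing \<open>d'\<close> would put this vector into the radical\<close>
      have "p dvd polar (g \<circ> \<psi>) (0, - z', 0, v) x" if "p dvd fst x" for x
        using that b d' k by (cases x) (simp add: g\<psi> polar_qform)
      moreover have "ternary_nondeg p (g \<circ> \<psi>)" using ternary_unimod(1)[OF \<psi>] nd by simp
      ultimately have "vdvd p (0, - z', 0, v)" by (intro ternary_nondegD) simp_all
      then show False using v by (simp add: vdvd_iff)
    qed
    then have "residue_count p (ternary_zeros p (g \<circ> \<psi>)) = nat p ^ 2"
      unfolding g\<psi> using ternary_count_normal_form[OF p b k v] by simp
    then show ?thesis using ternary_unimod(2)[OF \<psi> _ p0, of g] g unfolding quadratic_def by metis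
  qed
  have isotropic: "residue_count p (ternary_zeros p g) = nat p ^ 2"
    if g: "quadratic g" and nd: "ternary_nondeg p g" and e: "p dvd g ?e2" for g
  proof -
    obtain a b c d s t u v w z where gq: "g = qform a b c d s t u v w z"
      using g unfolding quadratic_def by blast
    have b: "p dvd b" using e by (simp add: gq qform_def)
    show ?thesis
    proof (cases "p dvd v")
      case False
      then show ?thesis using isotropic_first[OF gq nd b] by simp
    next
      case True
      have "\<not> p dvd w"
      proof
        assume "p dvd w"
        then have "p dvd polar g ?e2 x" if "p dvd fst x" for x
          using that b True by (cases x) (simp add: gq polar_qform)
        then have "vdvd p ?e2" by (intro ternary_nondegD[OF nd]) simp_all
        then show False using unit by (simp add: vdvd_iff)
      qed
      moreover have sw: "unimod swap34" "\<And>x. fst (swap34 x) = fst x"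
        by (rule unimod_gens) (simp add: generator_defs split_def)
      moreover have "g \<circ> swap34 = qform a b d c s u t w v z"
        unfolding gq by (auto simp: generator_defs qform_def algebra_simps)
      ultimately have "residue_count p (ternary_zeros p (g \<circ> swap34)) = nat p ^ 2"
        using isotropic_first[of "g \<circ> swap34"] b nd ternary_unimod(1)[OF sw] by blast
      then show ?thesis using ternary_unimod(2)[OF sw g p0] by simp
    qed
  qed
  obtain x y r where xyr: "\<not> (p dvd x \<and> p dvd y \<and> p dvd r)"
    and iso: "p dvd b * x\<^sup>2 + c * y\<^sup>2 + d * r\<^sup>2 + v * x * y + w * x * r + z * y * r"
    using ternary_isotropic[OF p odd] by blast
  have move: "residue_count p (ternary_zeros p f) = nat p ^ 2"
    if \<sigma>: "unimod \<sigma>" "\<And>x. fst (\<sigma> x) = fst x" and x: "p dvd f (\<sigma> (0, x2, x3, x4))" "\<not> p dvd x2" for \<sigma> x2 x3 x4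
  proof -
    obtain k where k: "p dvd k * x2 - 1" using ex_mod_inverse p x(2) by blast
    define \<psi> where "\<psi> = (\<lambda>(y1, y2, y3, y4). (y1, y2, y3 + (k * x3) * y2, y4) :: vec)
       \<circ> (\<lambda>(y1, y2, y3, y4). (y1, y2, y3, y4 + (k * x4) * y2))"
    have \<psi>: "unimod (\<psi>)" "\<And>x. fst (\<psi> x) = fst x"
      unfolding \<psi>_def by (intro unimod_comp unimod_shears) (simp add: split_def)
    define \<phi> where "\<phi> = \<sigma> \<circ> \<psi>"
    have \<phi>: "unimod \<phi>" "\<And>x. fst (\<phi> x) = fst x"
      unfolding \<phi>_def using \<sigma> \<psi> by (simp_all add: unimod_comp)
    have "vdvd p (\<psi> ?e2 - smul k (0, x2, x3, x4))"
      using k by (simp add: \<psi>_def smul_def vdvd_iff zero_prod_def dvd_diff_commute)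
    then have "vdvd p (\<sigma> (\<psi> ?e2) - smul k (\<sigma> (0, x2, x3, x4)))"
      using vdvd_unimod[OF \<sigma>(1)] unimod_diff[OF \<sigma>(1)] unimod_linear(2)[OF \<sigma>(1)] by metis
    then have "p dvd f (\<sigma> (\<psi> ?e2)) \<longleftrightarrow> p dvd f (smul k (\<sigma> (0, x2, x3, x4)))"
      by (rule quadratic_dvd_cong(1)[OF f])
    then have "p dvd (f \<circ> \<phi>) ?e2" using x(1) by (simp add: \<phi>_def quadratic_laws(1)[OF f])
    moreover have "quadratic (f \<circ> \<phi>)" by (rule quadratic_unimod[OF \<phi>(1) f])
    ultimately have "residue_count p (ternary_zeros p (f \<circ> \<phi>)) = nat p ^ 2"
      using isotropic nd ternary_unimod(1)[OF \<phi>] by blast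
    then show ?thesis using ternary_unimod(2)[OF \<phi> f p0] by simp
  qed
  consider "\<not> p dvd x" | "\<not> p dvd y" | "\<not> p dvd r" using xyr by blast
  then show ?thesis
  proof cases
    case 1
    show ?thesis
      by (rule move[OF unimod_id _ _ 1, of y r]) (use iso in \<open>simp_all add: fq qform_def algebra_simps\<close>)
  next
    case 2
    show ?thesis
      by (rule move[OF unimod_gens(2) _ _ 2, of x r]) (use iso in \<open>simp_all add: generator_defs fq qform_def split_def algebra_simps\<close>)
  next
    case 3
    show ?thesis
      by (rule move[OF unimod_swaps(3) _ _ 3, of y x]) (use iso in \<open>simp_all add: fq qform_def split_def algebra_simps\<close>)
  qed
qed

section \<open>Primes different from 13\<close>

text \<open>The multipliers are the rows of \<open>13\<close> times the inverse Gram matrix of \<open>Q\<close>.\<close>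

lemma vdvd_13_if_radical:
  assumes "\<not> nonradical p y"
  shows "vdvd p (smul 13 y)"
proof -
  obtain y1 y2 y3 y4 where y: "y = (y1, y2, y3, y4)" by (cases y)
  have "p dvd polar Q y x" for x using assms unfolding nonradical_def by blast
  from this[of "(1,0,0,0)"] this[of "(0,1,0,0)"] this[of "(0,0,1,0)"] this[of "(0,0,0,1)"]
  have b: "p dvd 2*y1 + y3 + y4" "p dvd 4*y2 + y4" "p dvd y1 + 2*y3" "p dvd y1 + y2 + 2*y4"
    unfolding y Q_eq_qform polar_qform by simp_all
  have comb: "p dvd k1 * (2*y1 + y3 + y4) + k2 * (4*y2 + y4) + k3 * (y1 + 2*y3) + k4 * (y1 + y2 + 2*y4)"
    for k1 k2 k3 k4
    by (rule dvd_add[OF dvd_add[OF dvd_add[OF dvd_mult[OF b(1)] dvd_mult[OF b(2)]] dvd_mult[OF b(3)]] dvd_mult[OF b(4)]])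
  show ?thesis
    using comb[of 14 2 "-7" "-8"] comb[of 2 4 "-1" "-3"] comb[of "-7" "-1" 10 4] comb[of "-8" "-3" 4 12]
    unfolding y smul_def by (simp add: vdvd_iff algebra_simps)
qed

lemma nonradical_iff:
  assumes p: "prime p" "p \<noteq> 13"
  shows "nonradical p y \<longleftrightarrow> \<not> vdvd p y"
proof
  assume "\<not> vdvd p y"
  show "nonradical p y"
  proof (rule ccontr)
    assume "\<not> nonradical p y"
    then have "vdvd p (smul 13 y)" by (rule vdvd_13_if_radical)
    moreover have "prime (13 :: int)" by simp
    then have "\<not> p dvd 13" using primes_dvd_imp_eq[OF p(1)] p(2) by blast
    ultimately show False
      using p(1) \<open>\<not> vdvd p y\<close> by (cases y) (simp add: smul_def vdvd_iff prime_dvd_mult_iff)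
  qed
qed (rule nonradical_not_vdvd)

definition ortho_cone :: "int \<Rightarrow> vec \<Rightarrow> vec set" where
  "ortho_cone p w = {y. p dvd Q y \<and> p dvd polar Q y w}"

lemma periodic_ortho_cone: "periodic p (ortho_cone p w)"
  unfolding periodic_def ortho_cone_def using quadratic_dvd_cong[OF quadratic_Q] by blast

text \<open>In a basis starting with \<open>w\<close>, shears make the other basis vectors orthogonal to \<open>w\<close> modulo \<open>p\<close>,
  since \<open>b(w, w) = 2 Q(w)\<close> is invertible. Orthogonality to \<open>w\<close> becomes the vanishing of the first
  coordinate, and the zeros are those of a nondegenerate ternary form.\<close>

lemma residue_count_ortho_cone_odd:
  assumes p: "prime p" "p \<noteq> 13" and odd: "odd p" and w: "\<not> p dvd Q w"
  shows "residue_count p (ortho_cone p w) = nat p ^ 2"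
proof -
  let ?e = "(1, 0, 0, 0) :: vec"
  have p0: "p > 0" using prime_gt_0_int[OF p(1)] .
  have two: "\<not> p dvd 2"
  proof
    assume "p dvd 2"
    then have "p \<le> 2" by (rule zdvd_imp_le) simp
    then have "p = 2" using prime_gt_1_int[OF p(1)] by simp
    then show False using odd by simp
  qed
  have "\<not> vdvd p w" using w by (auto simp: vdvd_def quadratic_laws(1)[OF quadratic_Q] power2_eq_square)
  then obtain \<phi> r where \<phi>: "unimod \<phi>" "\<not> p dvd r" "vdvd p (\<phi> ?e - smul r w)"
    using primitive_to_e1[OF p(1)] by blast
  define f where "f = Q \<circ> \<phi>"
  have f: "quadratic f" unfolding f_def by (rule quadratic_unimod[OF \<phi>(1) quadratic_Q])
  have perp: "p dvd polar Q y (\<phi> ?e) \<longleftrightarrow> p dvd polar Q y w" for y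
    using quadratic_dvd_cong(3)[OF quadratic_Q \<phi>(3)] p(1) \<phi>(2)
    by (simp add: quadratic_laws(4)[OF quadratic_Q] prime_dvd_mult_iff)
  have a: "\<not> p dvd f ?e"
    using quadratic_dvd_cong(1)[OF quadratic_Q \<phi>(3)] p(1) \<phi>(2) w
    by (simp add: f_def quadratic_laws(1)[OF quadratic_Q] prime_dvd_mult_iff prime_dvd_power_iff)
  then have a2: "\<not> p dvd 2 * f ?e" using two p(1) by (simp add: prime_dvd_mult_iff)
  obtain k2 k3 k4 where k:
    "p dvd polar f ?e (0,1,0,0) + k2 * (2 * f ?e)"
    "p dvd polar f ?e (0,0,1,0) + k3 * (2 * f ?e)"
    "p dvd polar f ?e (0,0,0,1) + k4 * (2 * f ?e)"
    using dvd_solve[OF p(1) a2] by metis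
  define \<psi> where "\<psi> = (\<lambda>(x1, x2, x3, x4). (x1 + k2 * x2, x2, x3, x4) :: vec) \<circ>
    ((\<lambda>(x1, x2, x3, x4). (x1 + k3 * x3, x2, x3, x4)) \<circ> (\<lambda>(x1, x2, x3, x4). (x1 + k4 * x4, x2, x3, x4)))"
  have \<psi>: "unimod \<psi>" unfolding \<psi>_def by (intro unimod_comp unimod_shears)
  have \<psi>_eq: "\<psi> (x1, x2, x3, x4) = (x1 + k2 * x2 + k3 * x3 + k4 * x4, x2, x3, x4)" for x1 x2 x3 x4
    by (simp add: \<psi>_def)
  define g where "g = f \<circ> \<psi>"
  have g: "quadratic g" unfolding g_def by (rule quadratic_unimod[OF \<psi> f])
  obtain a b c d s t u v w' z where fq: "f = qform a b c d s t u v w' z"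
    using f unfolding quadratic_def by blast
  have pol: "p dvd polar g y ?e \<longleftrightarrow> p dvd fst y" for y
  proof (cases y)
    case (fields y1 y2 y3 y4)
    have "polar g y ?e = y1 * (2 * a) + y2 * (s + k2 * (2 * a)) + y3 * (t + k3 * (2 * a)) + y4 * (u + k4 * (2 * a))"
      unfolding g_def polar_unimod[OF \<psi>] fields \<psi>_eq fq by (simp add: polar_qform algebra_simps)
    moreover have "p dvd s + k2 * (2 * a)" "p dvd t + k3 * (2 * a)" "p dvd u + k4 * (2 * a)" "\<not> p dvd 2 * a"
      using k a2 by (simp_all add: fq polar_qform) (simp_all add: qform_def)
    ultimately show ?thesis
      using p(1) by (simp add: fields dvd_add_left_iff prime_dvd_mult_iff)
  qed
  have \<phi>\<psi>: "unimod (\<phi> \<circ> \<psi>)" by (rule unimod_comp[OF \<phi>(1) \<psi>])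
  have g_eq: "g = Q \<circ> (\<phi> \<circ> \<psi>)" by (simp add: g_def f_def comp_assoc)
  have "\<psi> ?e = ?e" by (simp add: \<psi>_eq)
  then have "(\<phi> \<circ> \<psi>) -` ortho_cone p w = ternary_zeros p g"
    using pol perp
    by (auto simp: ortho_cone_def ternary_zeros_def g_eq polar_unimod[OF \<phi>\<psi>])
  then have "residue_count p (ortho_cone p w) = residue_count p (ternary_zeros p g)"
    using residue_count_unimod[OF p0 \<phi>\<psi> periodic_ortho_cone] by metis
  also have "\<dots> = nat p ^ 2"
  proof (rule ternary_count[OF p(1) odd g])
    show "ternary_nondeg p g"
      unfolding ternary_nondeg_def
    proof (intro allI impI)
      fix y assume y: "p dvd fst y" "\<forall>x. p dvd fst x \<longrightarrow> p dvd polar g y x"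
      have "p dvd polar g y x" for x
      proof (cases x)
        case (fields x1 x2 x3 x4)
        then have "x = smul x1 ?e + (0, x2, x3, x4)" by (simp add: smul_def)
        then have "polar g y x = x1 * polar g y ?e + polar g y (0, x2, x3, x4)"
          by (simp only: quadratic_laws(3,4)[OF g])
        then show ?thesis using y pol[of y] by simp
      qed
      then have "p dvd polar Q ((\<phi> \<circ> \<psi>) y) x" for x
        using unimod_inverse[OF \<phi>\<psi>] unfolding g_eq polar_unimod[OF \<phi>\<psi>] by metis
      then have "vdvd p ((\<phi> \<circ> \<psi>) y)" using nonradical_iff[OF p] unfolding nonradical_def by metis
      then show "vdvd p y" using vdvd_unimod[OF \<phi>\<psi>] by metis
    qed
  qed
  finally show ?thesis .
qed

text \<open>Modulo \<open>2\<close> a vector is orthogonal to itself, so the argument for odd primes breaks down; the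
  sixteen residue classes of \<open>w\<close> are checked by computation.\<close>

lemma residue_count_ortho_cone_2:
  assumes "odd (Q w)"
  shows "residue_count 2 (ortho_cone 2 w) = 4"
proof -
  define L :: "vec list" where "L = List.product [0, 1] (List.product [0, 1] (List.product [0, 1] [0, 1]))"
  define q where "q = (\<lambda>(x1, x2, x3, x4). x1*x1 + x3*x3 + x4*x4 + x1*x3 + x1*x4 + x2*x4 :: int)"
  define b where "b = (\<lambda>(x1, x2, x3, x4) (y1, y2, y3, y4).
    (x3 + x4) * y1 + x4 * y2 + x1 * y3 + (x1 + x2) * y4 :: int)"
  have q: "q y mod 2 = 0 \<longleftrightarrow> even (Q y)" for y
  proof (cases y)
    case (fields y1 y2 y3 y4)
    have "Q y = q y + 2 * y2\<^sup>2" by (simp add: fields q_def Q_def power2_eq_square)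
    then show ?thesis by presburger
  qed
  have b: "b y w mod 2 = 0 \<longleftrightarrow> even (polar Q y w)" for y w
  proof (cases y, cases w)
    fix y1 y2 y3 y4 w1 w2 w3 w4 assume yw: "y = (y1, y2, y3, y4)" "w = (w1, w2, w3, w4)"
    have "polar Q y w = b y w + 2 * (y1 * w1 + 2 * y2 * w2 + y3 * w3 + y4 * w4)"
      unfolding yw Q_eq_qform polar_qform b_def by (simp add: algebra_simps)
    then show ?thesis by presburger
  qed
  have "list_all (\<lambda>w. q w mod 2 \<noteq> 0 \<longrightarrow> length (filter (\<lambda>y. q y mod 2 = 0 \<and> b y w mod 2 = 0) L) = 4) L"
    unfolding L_def q_def b_def by code_simp
  then have *: "length (filter (\<lambda>y. even (Q y) \<and> even (polar Q y w)) L) = 4"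
    if "w \<in> set L" "odd (Q w)" for w
    using that unfolding q b list_all_iff by blast
  have "{0..<2::int} = {0, 1}" by auto
  then have box: "box 2 = set L" by (simp add: box_def L_def)
  have "distinct L" by (simp add: L_def distinct_product)
  define w' where "w' = reduce_mod 2 w"
  have w': "vdvd 2 (w' - w)" unfolding w'_def by (rule vdvd_reduce_mod)
  have "odd (Q w')" using quadratic_dvd_cong(1)[OF quadratic_Q w'] assms by simp
  moreover have "w' \<in> set L" using reduce_mod_in_box[of 2 w] box by (simp add: w'_def)
  ultimately have "length (filter (\<lambda>y. even (Q y) \<and> even (polar Q y w')) L) = 4" by (intro *)
  then have len: "card (set (filter (\<lambda>y. even (Q y) \<and> even (polar Q y w')) L)) = 4"
    using distinct_card[OF distinct_filter[OF \<open>distinct L\<close>]] by simp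
  have perp: "even (polar Q y w') \<longleftrightarrow> even (polar Q y w)" for y
    by (rule quadratic_dvd_cong(3)[OF quadratic_Q w'])
  have "ortho_cone 2 w \<inter> box 2 = set (filter (\<lambda>y. even (Q y) \<and> even (polar Q y w')) L)"
    unfolding box set_filter ortho_cone_def perp by blast
  then show ?thesis unfolding residue_count_def using len by simp
qed

lemma card_cone_perp:
  assumes p: "prime p" "p \<noteq> 13" and w: "\<not> p dvd Q w"
  shows "card {y \<in> cone p. p dvd polar Q y w} = nat p ^ 2 - 1"
proof -
  have p0: "p > 0" using prime_gt_0_int[OF p(1)] .
  have "residue_count p (ortho_cone p w) = nat p ^ 2"
  proof (cases "p = 2")
    case True then show ?thesis using residue_count_ortho_cone_2[of w] w by simp
  next
    case False
    then have "p > 2" using prime_gt_1_int[OF p(1)] by simp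
    then have "odd p" using p(1) by (rule prime_odd_int[rotated])
    then show ?thesis using residue_count_ortho_cone_odd[OF p _ w] by simp
  qed
  moreover have "{y \<in> cone p. p dvd polar Q y w} = (ortho_cone p w \<inter> box p) - {0}"
  proof -
    have "vdvd p y \<longleftrightarrow> y = 0" if "y \<in> box p" for y
    proof
      assume "vdvd p y"
      then have "reduce_mod p y = reduce_mod p 0" by (intro reduce_mod_eqI) simp
      then show "y = 0" using reduce_mod_box[OF that] by (simp add: reduce_mod_def zero_prod_def)
    qed (simp add: vdvd_0)
    then show ?thesis unfolding cone_def ortho_cone_def using nonradical_iff[OF p] by blast
  qed
  moreover have "0 \<in> ortho_cone p w \<inter> box p"
    using p0 polar_dvd(2)[OF quadratic_Q vdvd_0] by (auto simp: ortho_cone_def Q_def box_def zero_prod_def)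
  ultimately show ?thesis unfolding residue_count_def using finite_box by (simp add: card_Diff_singleton)
qed

text \<open>The vectors of norm \<open>p\<^sup>2 n\<close> that are divisible by \<open>p\<close> are the multiples of those of norm \<open>n\<close>.\<close>

lemma card_level_split:
  assumes "p \<noteq> 0"
  shows "card {z. Q z = p\<^sup>2 * n} = card {z. Q z = p\<^sup>2 * n \<and> \<not> vdvd p z} + card {w. Q w = n}"
proof -
  have "{z. Q z = p\<^sup>2 * n} = {z. Q z = p\<^sup>2 * n \<and> \<not> vdvd p z} \<union> smul p ` {w. Q w = n}"
    using assms by (auto simp: vdvd_def quadratic_laws(1)[OF quadratic_Q] image_iff)
  moreover have "{z. Q z = p\<^sup>2 * n \<and> \<not> vdvd p z} \<inter> smul p ` {w. Q w = n} = {}"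
    using vdvd_smul_self by blast
  moreover have "finite {z. Q z = p\<^sup>2 * n}" using card_level_set(2)[OF pos_form13_Q] .
  moreover have "card (smul p ` {w. Q w = n}) = card {w. Q w = n}"
    using smul_inject[OF assms] by (intro card_image) (auto simp: inj_on_def)
  ultimately show ?thesis by (metis (no_types, lifting) card_Un_disjoint finite_Un)
qed

text \<open>An eigenvalue equation for the Hecke operator at \<open>p\<^sup>2\<close>, on coefficients prime to \<open>p\<close>.\<close>

theorem hecke_relation:
  assumes p: "prime p" "p \<noteq> 13" and n: "\<not> p dvd n"
  shows "(p - 1) * int (card {z. Q z = p\<^sup>2 * n}) =
    (int (card (cone p)) - p\<^sup>2 + p) * int (card {w. Q w = n})"
proof -
  have p1: "p > 1" using prime_gt_1_int[OF p(1)] .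
  have "card (cone p) * card {w. Q w = n} = nat (p - 1) * card {z. Q z = p\<^sup>2 * n \<and> \<not> vdvd p z}
    + (\<Sum>w | Q w = n. card {y \<in> cone p. p dvd polar Q y w})"
    using neighbour_identity[OF p(1), of n] nonradical_iff[OF p] by simp
  also have "(\<Sum>w | Q w = n. card {y \<in> cone p. p dvd polar Q y w}) = (\<Sum>w | Q w = n. nat p ^ 2 - 1)"
    by (intro sum.cong refl card_cone_perp[OF p]) (use n in auto)
  finally have *: "card (cone p) * card {w. Q w = n} = nat (p - 1) * card {z. Q z = p\<^sup>2 * n \<and> \<not> vdvd p z}
    + card {w. Q w = n} * (nat p ^ 2 - 1)" by simp
  have "int (nat p ^ 2 - 1) = p\<^sup>2 - 1" using p1 by (simp add: of_nat_diff)
  then have "int (card (cone p)) * int (card {w. Q w = n})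
    = (p - 1) * int (card {z. Q z = p\<^sup>2 * n \<and> \<not> vdvd p z}) + int (card {w. Q w = n}) * (p\<^sup>2 - 1)"
    using arg_cong[OF *, of int] p1 by (simp add: of_nat_mult)
  then show ?thesis using card_level_split[of p n] p1 by (simp add: algebra_simps power2_eq_square)
qed

section \<open>The prime 13\<close>

text \<open>The squares modulo \<open>13\<close> are \<open>0, 1, 3, 4, 9, 10, 12\<close>.\<close>

lemma two_nonresidue_13:
  fixes m n :: int
  assumes "13 dvd n\<^sup>2 - 2 * m\<^sup>2"
  shows "13 dvd m"
proof (rule ccontr)
  assume "\<not> 13 dvd m"
  then obtain k where "13 dvd k * m - 1" using ex_mod_inverse[of 13 m] by auto
  then obtain l where l: "k * m = 1 + 13 * l" by (metis add.commute diff_add_cancel dvdE)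
  have "13 dvd k\<^sup>2 * (n\<^sup>2 - 2 * m\<^sup>2)" using assms by simp
  also have "k\<^sup>2 * (n\<^sup>2 - 2 * m\<^sup>2) = (k * n)\<^sup>2 - 2 * (k * m)\<^sup>2"
    by (simp add: algebra_simps power2_eq_square)
  also have "\<dots> = ((k * n)\<^sup>2 - 2) - 13 * (4 * l + 26 * l\<^sup>2)"
    unfolding l by (simp add: algebra_simps power2_eq_square)
  finally have "13 dvd (k * n)\<^sup>2 - 2" by (simp only: dvd_diff_left_iff dvd_triv_left)
  then have "(k * n)\<^sup>2 mod 13 = 2" by presburger
  then have "((k * n) mod 13)\<^sup>2 mod 13 = 2" by (simp add: power_mod)
  moreover have "x = 0 \<or> x = 1 \<or> x = 2 \<or> x = 3 \<or> x = 4 \<or> x = 5 \<or> x = 6 \<or> x = 7 \<or> x = 8 \<or> x = 9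
      \<or> x = 10 \<or> x = 11 \<or> x = 12" if "0 \<le> x" "x < 13" for x :: int
    using that by presburger
  from this[of "(k * n) mod 13"] have "(k * n) mod 13 \<in> {0,1,2,3,4,5,6,7,8,9,10,11,12}" by simp
  ultimately show False by auto
qed

lemma dvd_13_cancel:
  fixes x :: int
  assumes "13 dvd k * x" "k \<in> {2, 4, 6, 7, 12}"
  shows "13 dvd x"
proof -
  have "prime (13 :: int)" by simp
  then have "13 dvd k \<or> 13 dvd x" using assms(1) by (simp only: prime_dvd_mult_iff)
  then show ?thesis using assms(2) by auto
qed

text \<open>By \<open>Q_sum_of_squares\<close>, modulo \<open>13\<close> the form \<open>24 Q\<close> is diagonal in these three linear forms, whose
  common kernel is therefore the radical.\<close>

lemma radical_13_iff:
  "\<not> nonradical 13 (y1, y2, y3, y4) \<longleftrightarrow>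
     13 dvd 2 * y1 + y3 + y4 \<and> 13 dvd 4 * y2 + y4 \<and> 13 dvd 3 * y3 - y4"
  (is "?L \<longleftrightarrow> ?R")
proof -
  have pol: "polar Q (y1, y2, y3, y4) (x1, x2, x3, x4)
    = (2*y1 + y3 + y4) * x1 + (4*y2 + y4) * x2 + (y1 + 2*y3) * x3 + (y1 + y2 + 2*y4) * x4" for x1 x2 x3 x4
    by (simp add: Q_eq_qform polar_qform)
  show ?thesis
  proof
    assume ?L
    then have "13 dvd polar Q (y1, y2, y3, y4) x" for x unfolding nonradical_def by blast
    from this[of "(1,0,0,0)"] this[of "(0,1,0,0)"] this[of "(0,0,1,0)"]
    have "13 dvd 2 * y1 + y3 + y4" "13 dvd 4 * y2 + y4" "13 dvd y1 + 2 * y3" by (simp_all add: pol)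
    moreover have "3 * y3 - y4 = 2 * (y1 + 2 * y3) - (2 * y1 + y3 + y4)" by simp
    ultimately show ?R by (simp only: dvd_diff dvd_mult)
  next
    assume ?R
    then have ABC: "13 dvd 2 * y1 + y3 + y4" "13 dvd 4 * y2 + y4" "13 dvd 3 * y3 - y4" by simp_all
    have "2 * (y1 + 2 * y3) = (2 * y1 + y3 + y4) + (3 * y3 - y4)" by simp
    then have "13 dvd 2 * (y1 + 2 * y3)" using ABC by (simp only: dvd_add)
    then have c: "13 dvd y1 + 2 * y3" by (rule dvd_13_cancel) simp
    have "12 * (y1 + y2 + 2 * y4)
        = (6 * (2 * y1 + y3 + y4) + 3 * (4 * y2 + y4)) - 2 * (3 * y3 - y4) + 13 * y4" by simp
    then have "13 dvd 12 * (y1 + y2 + 2 * y4)" using ABC by (simp only: dvd_add dvd_diff dvd_mult dvd_triv_left)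
    then have d: "13 dvd y1 + y2 + 2 * y4" by (rule dvd_13_cancel) simp
    from ABC c d have "13 dvd polar Q (y1, y2, y3, y4) x" for x by (cases x) (simp add: pol)
    then show ?L unfolding nonradical_def by blast
  qed
qed

text \<open>If \<open>w\<close> and an isotropic \<open>y\<close> are orthogonal in a ternary space with diagonal form
  \<open>(\<alpha>, \<beta>, \<gamma>)\<close>, then Lagrange's identity for the last two coordinates gives
  \<open>\<alpha> A\<^sup>2 q(w) + \<beta> \<gamma> (B C' - C B')\<^sup>2 = 0\<close>, and cyclically. For \<open>(6, 3, 2)\<close> modulo \<open>13\<close> and
  \<open>q(w) = 24\<close> each of these three equations makes twice a square equal to a square, so all coordinates
  of \<open>y\<close> vanish.\<close>

lemma cone_13_not_perp:
  assumes w: "Q w = 1" and y: "13 dvd Q y" "13 dvd polar Q y w"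
  shows "\<not> nonradical 13 y"
proof -
  obtain y1 y2 y3 y4 w1 w2 w3 w4 where yw: "y = (y1, y2, y3, y4)" "w = (w1, w2, w3, w4)"
    by (cases y, cases w)
  define A B C A' B' C' where defs: "A = 2 * y1 + y3 + y4" "B = 4 * y2 + y4" "C = 3 * y3 - y4"
    "A' = 2 * w1 + w3 + w4" "B' = 4 * w2 + w4" "C' = 3 * w3 - w4"
  define qy qw b where forms: "qy = 6 * A\<^sup>2 + 3 * B\<^sup>2 + 2 * C\<^sup>2"
    "qw = 6 * A'\<^sup>2 + 3 * B'\<^sup>2 + 2 * C'\<^sup>2" "b = 6 * (A * A') + 3 * (B * B') + 2 * (C * C')"
  have "24 * Q y = qy + 13 * y4\<^sup>2"
    unfolding yw forms defs by (rule Q_sum_of_squares)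
  then have "qy = 24 * Q y - 13 * y4\<^sup>2" by simp
  then have "13 dvd qy" using y(1) by (simp only: dvd_diff dvd_mult dvd_triv_left)
  moreover have "12 * polar Q y w = b + 13 * (y4 * w4)"
    unfolding yw forms defs Q_eq_qform polar_qform by (simp add: algebra_simps)
  then have "b = 12 * polar Q y w - 13 * (y4 * w4)" by simp
  then have "13 dvd b" using y(2) by (simp only: dvd_diff dvd_mult dvd_triv_left)
  ultimately obtain k l where kl: "qy = 13 * k" "b = 13 * l" by blast
  have "24 * Q w = qw + 13 * w4\<^sup>2"
    unfolding yw forms defs by (rule Q_sum_of_squares)
  then have qw: "qw = 24 - 13 * w4\<^sup>2" using w by simp
  have "6 * A\<^sup>2 * qw + 6 * (B * C' - C * B')\<^sup>2 = qy * (qw - 6 * A'\<^sup>2) + 12 * A * A' * b - b\<^sup>2"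
    unfolding forms by (simp add: algebra_simps power2_eq_square)
  then have "6 * (24 * A\<^sup>2 + (B * C' - C * B')\<^sup>2)
      = 13 * (k * (24 - 13 * w4\<^sup>2 - 6 * A'\<^sup>2) + 12 * A * A' * l - 13 * l\<^sup>2 + 6 * A\<^sup>2 * w4\<^sup>2)"
    unfolding kl qw by (simp add: algebra_simps power2_eq_square)
  then have "13 dvd 6 * (24 * A\<^sup>2 + (B * C' - C * B')\<^sup>2)" by (simp only: dvd_triv_left)
  then have "13 dvd 24 * A\<^sup>2 + (B * C' - C * B')\<^sup>2" by (rule dvd_13_cancel) simp
  moreover have "(B * C' - C * B')\<^sup>2 - 2 * A\<^sup>2 = (24 * A\<^sup>2 + (B * C' - C * B')\<^sup>2) - 13 * (2 * A\<^sup>2)"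
    by linarith
  ultimately have "13 dvd (B * C' - C * B')\<^sup>2 - 2 * A\<^sup>2" by (simp only: dvd_diff dvd_triv_left)
  then have A: "13 dvd A" by (rule two_nonresidue_13)
  have "3 * B\<^sup>2 * qw + 12 * (A * C' - C * A')\<^sup>2 = qy * (qw - 3 * B'\<^sup>2) + 6 * B * B' * b - b\<^sup>2"
    unfolding forms by (simp add: algebra_simps power2_eq_square)
  then have "12 * (6 * B\<^sup>2 + (A * C' - C * A')\<^sup>2)
      = 13 * (k * (24 - 13 * w4\<^sup>2 - 3 * B'\<^sup>2) + 6 * B * B' * l - 13 * l\<^sup>2 + 3 * B\<^sup>2 * w4\<^sup>2)"
    unfolding kl qw by (simp add: algebra_simps power2_eq_square)
  then have "13 dvd 12 * (6 * B\<^sup>2 + (A * C' - C * A')\<^sup>2)" by (simp only: dvd_triv_left)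
  then have "13 dvd 6 * B\<^sup>2 + (A * C' - C * A')\<^sup>2" by (rule dvd_13_cancel) simp
  moreover have "(A * C' - C * A')\<^sup>2 - 2 * (6 * B)\<^sup>2 = (6 * B\<^sup>2 + (A * C' - C * A')\<^sup>2) - 13 * (6 * B\<^sup>2)"
    unfolding power_mult_distrib[of 6 B] by simp
  ultimately have "13 dvd (A * C' - C * A')\<^sup>2 - 2 * (6 * B)\<^sup>2" by (simp only: dvd_diff dvd_triv_left)
  then have "13 dvd 6 * B" by (rule two_nonresidue_13)
  then have B: "13 dvd B" by (rule dvd_13_cancel) simp
  have "2 * C\<^sup>2 * qw + 18 * (A * B' - B * A')\<^sup>2 = qy * (qw - 2 * C'\<^sup>2) + 4 * C * C' * b - b\<^sup>2"
    unfolding forms by (simp add: algebra_simps power2_eq_square)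
  then have "6 * (8 * C\<^sup>2 + 3 * (A * B' - B * A')\<^sup>2)
      = 13 * (k * (24 - 13 * w4\<^sup>2 - 2 * C'\<^sup>2) + 4 * C * C' * l - 13 * l\<^sup>2 + 2 * C\<^sup>2 * w4\<^sup>2)"
    unfolding kl qw by (simp add: algebra_simps power2_eq_square)
  then have "13 dvd 6 * (8 * C\<^sup>2 + 3 * (A * B' - B * A')\<^sup>2)" by (simp only: dvd_triv_left)
  then have "13 dvd 8 * C\<^sup>2 + 3 * (A * B' - B * A')\<^sup>2" by (rule dvd_13_cancel) simp
  moreover have "(A * B' - B * A')\<^sup>2 - 2 * (4 * C)\<^sup>2
      = 9 * (8 * C\<^sup>2 + 3 * (A * B' - B * A')\<^sup>2) - 13 * (8 * C\<^sup>2 + 2 * (A * B' - B * A')\<^sup>2)"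
    unfolding power_mult_distrib[of 4 C] by simp
  ultimately have "13 dvd (A * B' - B * A')\<^sup>2 - 2 * (4 * C)\<^sup>2"
    by (simp only: dvd_diff dvd_mult dvd_triv_left)
  then have "13 dvd 4 * C" by (rule two_nonresidue_13)
  then have C: "13 dvd C" by (rule dvd_13_cancel) simp
  show ?thesis using A B C unfolding yw defs radical_13_iff by blast
qed

text \<open>The vector \<open>(1, 2, 6, 5)\<close> spans the radical of \<open>Q\<close> modulo \<open>13\<close>; this substitution makes it the
  first basis vector.\<close>

definition split_13 :: "vec \<Rightarrow> vec" where
  "split_13 = (\<lambda>(x1, x2, x3, x4). (x1, x2 + 2 * x1, x3 + 6 * x1, x4 + 5 * x1))"

lemma unimod_split_13: "unimod split_13"
proof -
  have "split_13 = (\<lambda>(x1, x2, x3, x4). (x1, x2 + 2 * x1, x3, x4)) \<circ>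
    ((\<lambda>(x1, x2, x3, x4). (x1, x2, x3 + 6 * x1, x4)) \<circ> (\<lambda>(x1, x2, x3, x4). (x1, x2, x3, x4 + 5 * x1)))"
    by (auto simp: split_13_def)
  moreover have "unimod \<dots>" by (intro unimod_comp unimod_shears)
  ultimately show ?thesis by simp
qed

lemma Q_split_13: "Q \<circ> split_13 = qform 91 2 1 1 13 13 13 0 1 0"
  by (auto simp: split_13_def Q_def qform_def algebra_simps power2_eq_square)

lemma nonradical_split_13:
  "nonradical 13 (split_13 (y1, y2, y3, y4)) \<longleftrightarrow> \<not> (13 dvd y2 \<and> 13 dvd y3 \<and> 13 dvd y4)"
proof -
  have "13 dvd 2 * y1 + (y3 + 6 * y1) + (y4 + 5 * y1) \<longleftrightarrow> 13 dvd y3 + y4"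
    "13 dvd 4 * (y2 + 2 * y1) + (y4 + 5 * y1) \<longleftrightarrow> 13 dvd 4 * y2 + y4"
    "13 dvd 3 * (y3 + 6 * y1) - (y4 + 5 * y1) \<longleftrightarrow> 13 dvd 3 * y3 - y4"
  proof -
    have "2 * y1 + (y3 + 6 * y1) + (y4 + 5 * y1) = 13 * y1 + (y3 + y4)"
      "4 * (y2 + 2 * y1) + (y4 + 5 * y1) = 13 * y1 + (4 * y2 + y4)"
      "3 * (y3 + 6 * y1) - (y4 + 5 * y1) = 13 * y1 + (3 * y3 - y4)" by simp_all
    then show "13 dvd 2 * y1 + (y3 + 6 * y1) + (y4 + 5 * y1) \<longleftrightarrow> 13 dvd y3 + y4"
      "13 dvd 4 * (y2 + 2 * y1) + (y4 + 5 * y1) \<longleftrightarrow> 13 dvd 4 * y2 + y4"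
      "13 dvd 3 * (y3 + 6 * y1) - (y4 + 5 * y1) \<longleftrightarrow> 13 dvd 3 * y3 - y4"
      by (simp_all only: dvd_add_right_iff dvd_triv_left)
  qed
  moreover have "13 dvd y2 \<and> 13 dvd y3 \<and> 13 dvd y4"
    if h: "13 dvd y3 + y4" "13 dvd 4 * y2 + y4" "13 dvd 3 * y3 - y4"
  proof -
    have "4 * y3 = (y3 + y4) + (3 * y3 - y4)" by simp
    then have "13 dvd 4 * y3" using h by (simp only: dvd_add)
    then have y3: "13 dvd y3" by (rule dvd_13_cancel) simp
    then have y4: "13 dvd y4" using h(1) by (simp add: dvd_add_right_iff)
    then have "13 dvd 4 * y2" using h(2) by (simp only: dvd_add_left_iff)
    then show ?thesis using y3 y4 dvd_13_cancel by blast
  qed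
  moreover have "13 dvd y3 + y4" "13 dvd 4 * y2 + y4" "13 dvd 3 * y3 - y4"
    if h: "13 dvd y2" "13 dvd y3" "13 dvd y4"
    using h by (simp_all add: dvd_add dvd_diff dvd_mult)
  ultimately have iff: "13 dvd 2 * y1 + (y3 + 6 * y1) + (y4 + 5 * y1) \<and> 13 dvd 4 * (y2 + 2 * y1) + (y4 + 5 * y1)
      \<and> 13 dvd 3 * (y3 + 6 * y1) - (y4 + 5 * y1) \<longleftrightarrow> 13 dvd y2 \<and> 13 dvd y3 \<and> 13 dvd y4"
    by blast
  have eq: "split_13 (y1, y2, y3, y4) = (y1, y2 + 2 * y1, y3 + 6 * y1, y4 + 5 * y1)"
    by (simp add: split_13_def)
  show ?thesis
    unfolding eq using iff radical_13_iff[of y1 "y2 + 2 * y1" "y3 + 6 * y1" "y4 + 5 * y1"] by blast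
qed

text \<open>The cone over the \<open>13\<^sup>2 - 1\<close> nonzero zeros of a nondegenerate ternary form, the coordinate along the
  radical being free.\<close>

lemma card_cone_13: "card (cone 13) = 2184"
proof -
  let ?g = "qform 91 2 1 1 13 13 13 0 1 0"
  define S where "S = {y. 13 dvd Q y \<and> nonradical 13 y}"
  define T where "T = ternary_zeros 13 ?g \<inter> box 13 - {0}"
  have g: "quadratic ?g" unfolding quadratic_def by blast
  have fst0: "13 dvd x \<longleftrightarrow> x = 0" if "x \<in> {0..<13::int}" for x :: int using that zdvd_not_zless[of x 13] by force
  have first: "fst x = 0" if "x \<in> ternary_zeros 13 ?g \<inter> box 13" for x
    using that fst0[of "fst x"] by (auto simp: ternary_zeros_def box_def)
  have "card (cone 13) = residue_count 13 S"
    unfolding residue_count_def cone_def S_def by (rule arg_cong[of _ _ card]) blast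
  also have "\<dots> = residue_count 13 (split_13 -` S)"
  proof (rule residue_count_unimod[symmetric, OF _ unimod_split_13])
    show "periodic 13 S"
      unfolding periodic_def
    proof (intro allI impI)
      fix x y assume xy: "vdvd 13 (x - y)" "x \<in> S"
      then show "y \<in> S"
        using quadratic_dvd_cong(1)[OF quadratic_Q xy(1)] nonradical_cong[OF xy(1)] by (simp add: S_def)
    qed
  qed simp
  also have "\<dots> = card (split_13 -` S \<inter> box 13)" by (simp add: residue_count_def)
  also have "\<dots> = card ({0..<13::int} \<times> T)"
  proof (rule bij_betw_same_card)
    have "13 dvd Q (split_13 (y1, y2, y3, y4)) \<longleftrightarrow> 13 dvd ?g (0, y2, y3, y4)" for y1 y2 y3 y4
    proof -
      have "Q (split_13 (y1, y2, y3, y4)) = ?g (0, y2, y3, y4) + 13 * (7 * y1\<^sup>2 + y1 * y2 + y1 * y3 + y1 * y4)"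
        using fun_cong[OF Q_split_13, of "(y1, y2, y3, y4)"] by (simp add: qform_def algebra_simps)
      then show ?thesis by (simp add: dvd_add_left_iff)
    qed
    then have coords: "(y1, y2, y3, y4) \<in> split_13 -` S \<inter> box 13 \<longleftrightarrow>
        y1 \<in> {0..<13::int} \<and> (0, y2, y3, y4) \<in> T" for y1 y2 y3 y4
      using fst0[of y2] fst0[of y3] fst0[of y4]
      by (auto simp: T_def S_def nonradical_split_13 ternary_zeros_def box_def zero_prod_def)
    have mem: "y \<in> split_13 -` S \<inter> box 13 \<longleftrightarrow> fst y \<in> {0..<13::int} \<and> (0, snd y) \<in> T" for y
      using coords[of "fst y" "fst (snd y)" "fst (snd (snd y))" "snd (snd (snd y))"] by (simp only: prod.collapse)
    have T: "(0, snd x) = x" if "x \<in> T" for x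
      using first[of x] that unfolding T_def by (metis Diff_iff prod.collapse)
    show "bij_betw (\<lambda>y. (fst y, (0, snd y))) (split_13 -` S \<inter> box 13) ({0..<13::int} \<times> T)"
    proof (rule bij_betw_byWitness[where f' = "\<lambda>r. (fst r, snd (snd r))"])
      show "\<forall>y\<in>split_13 -` S \<inter> box 13. (fst (fst y, 0, snd y), snd (snd (fst y, 0, snd y))) = y"
        by (intro ballI) (simp only: fst_conv snd_conv prod.collapse)
      show "\<forall>r\<in>{0..<13} \<times> T. (fst (fst r, snd (snd r)), 0, snd (fst r, snd (snd r))) = r"
        using T by (intro ballI) (simp only: fst_conv snd_conv mem_Times_iff prod.collapse)
      show "(\<lambda>y. (fst y, 0, snd y)) ` (split_13 -` S \<inter> box 13) \<subseteq> {0..<13} \<times> T"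
        using mem by (intro image_subsetI) (simp only: mem_Times_iff fst_conv snd_conv)
      show "(\<lambda>r. (fst r, snd (snd r))) ` ({0..<13} \<times> T) \<subseteq> split_13 -` S \<inter> box 13"
        using mem T by (intro image_subsetI) (simp only: mem_Times_iff fst_conv snd_conv)
    qed
  qed
  also have "\<dots> = 13 * (card (ternary_zeros 13 ?g \<inter> box 13) - 1)"
  proof -
    have "0 \<in> ternary_zeros 13 ?g \<inter> box 13"
      by (simp add: ternary_zeros_def box_def zero_prod_def qform_def)
    then have "card T = card (ternary_zeros 13 ?g \<inter> box 13) - 1"
      unfolding T_def using finite_box[of 13] by (intro card_Diff_singleton)
    then show ?thesis by (simp only: card_cartesian_product) simp
  qed
  also have "card (ternary_zeros 13 ?g \<inter> box 13) = 169"
  proof -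
    have "ternary_nondeg 13 ?g"
      unfolding ternary_nondeg_def
    proof (intro allI impI)
      fix y assume y: "13 dvd fst y" "\<forall>x. 13 dvd fst x \<longrightarrow> 13 dvd polar ?g y x"
      obtain y1 y2 y3 y4 where yy: "y = (y1, y2, y3, y4)" by (cases y)
      have "13 dvd y1" "13 dvd 13 * y1 + 4 * y2 + y4" "13 dvd 13 * y1 + 2 * y3" "13 dvd 13 * y1 + y2 + 2 * y4"
        using y(1) y(2)[rule_format, of "(0,1,0,0)"] y(2)[rule_format, of "(0,0,1,0)"] y(2)[rule_format, of "(0,0,0,1)"]
        by (simp_all add: yy polar_qform)
      then have h: "13 dvd y1" "13 dvd 4 * y2 + y4" "13 dvd 2 * y3" "13 dvd y2 + 2 * y4"
        by (simp_all add: add.assoc dvd_add_right_iff)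
      have y3: "13 dvd y3" using h(3) by (rule dvd_13_cancel) simp
      have "7 * y4 = 4 * (y2 + 2 * y4) - (4 * y2 + y4)" by simp
      then have "13 dvd 7 * y4" using h by (simp only: dvd_diff dvd_mult)
      then have y4: "13 dvd y4" by (rule dvd_13_cancel) simp
      then have y2: "13 dvd y2" using h(4) by (simp only: dvd_add_left_iff dvd_mult)
      show "vdvd 13 y" using h(1) y2 y3 y4 by (simp add: yy vdvd_iff)
    qed
    then show ?thesis using ternary_count[of 13 ?g] g by (simp add: residue_count_def)
  qed
  finally show ?thesis by simp
qed

text \<open>The norm \<open>91 = 7 * 13\<close> of the radical vector is not divisible by \<open>13\<^sup>2\<close>.\<close>

lemma radical_13_norm:
  assumes "\<not> nonradical 13 z" "169 dvd Q z"
  shows "vdvd 13 z"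
proof -
  obtain y where z: "z = split_13 y" using unimod_inverse[OF unimod_split_13] by metis
  obtain y1 y2 y3 y4 where y: "y = (y1, y2, y3, y4)" by (cases y)
  have "13 dvd y2 \<and> 13 dvd y3 \<and> 13 dvd y4" using assms(1) by (simp add: z y nonradical_split_13)
  then obtain k2 k3 k4 where k: "y2 = 13 * k2" "y3 = 13 * k3" "y4 = 13 * k4" by blast
  have "Q z = 91 * y1\<^sup>2 + 169 * (y1 * k2 + y1 * k3 + y1 * k4 + 2 * k2\<^sup>2 + k3\<^sup>2 + k4\<^sup>2 + k2 * k4)"
    using fun_cong[OF Q_split_13, of y] unfolding z by (simp add: y k qform_def algebra_simps power2_eq_square)
  then have "169 dvd 91 * y1\<^sup>2" using assms(2) by (simp only: dvd_add_left_iff dvd_triv_left)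
  then obtain m where "91 * y1\<^sup>2 = 169 * m" by blast
  then have "7 * y1\<^sup>2 = 13 * m" by simp
  then have "13 dvd 7 * y1\<^sup>2" by (simp only: dvd_triv_left)
  then have "13 dvd y1\<^sup>2" by (rule dvd_13_cancel) simp
  then have "13 dvd y1" using prime_dvd_power[of 13 y1 2] by simp
  then have "vdvd 13 y" by (simp add: y k vdvd_iff)
  then show ?thesis unfolding z using vdvd_unimod[OF unimod_split_13] by simp
qed

text \<open>The neighbour identity for \<open>p = 13\<close> and \<open>n = 1\<close>, where the sum over \<open>w\<close> vanishes; here
  \<open>183 = 2184 / 12 + 1\<close>.\<close>

lemma card_level_169: "card {z. Q z = 169} = 183 * card {w. Q w = 1}"
proof -
  have "card {y \<in> cone 13. 13 dvd polar Q y w} = 0" if "Q w = 1" for w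
  proof -
    have "{y \<in> cone 13. 13 dvd polar Q y w} = {}" using cone_13_not_perp[OF that] unfolding cone_def by blast
    then show ?thesis by (simp only: card.empty)
  qed
  then have "(\<Sum>w | Q w = 1. card {y \<in> cone 13. 13 dvd polar Q y w}) = 0" by simp
  moreover have "nonradical 13 z \<longleftrightarrow> \<not> vdvd 13 z" if "Q z = 169" for z
    using radical_13_norm[of z] nonradical_not_vdvd[of 13 z] that by auto
  then have "{z. Q z = 169 \<and> nonradical 13 z} = {z. Q z = 169 \<and> \<not> vdvd 13 z}" by blast
  ultimately show ?thesis
    using neighbour_identity[of 13 1] card_level_split[of 13 1] by (simp add: card_cone_13)
qed

lemma card_level_1: "card {x. Q x = 1} \<le> 12" "card {x. Q x = 1} > 0"
proof -
  let ?S = "{(1,0,0,0), (0,0,1,0), (0,0,0,1), (1,0,-1,0), (1,0,0,-1), (1,0,-1,-1),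
    (-1,0,0,0), (0,0,-1,0), (0,0,0,-1), (-1,0,1,0), (-1,0,0,1), (-1,0,1,1)} :: vec set"
  have small: "\<bar>x\<bar> \<le> k" if "x\<^sup>2 < (k + 1)\<^sup>2" "k \<ge> 0" for x k :: int
    using power2_less_imp_less[of "\<bar>x\<bar>" "k + 1"] that by simp
  have "{x. Q x = 1} \<subseteq> ?S"
  proof
    fix x assume "x \<in> {x. Q x = 1}"
    moreover obtain x1 x2 x3 x4 where x: "x = (x1, x2, x3, x4)" by (cases x)
    ultimately have Q1: "Q (x1, x2, x3, x4) = 1" by simp
    then have "24 = 6 * (2 * x1 + x3 + x4)\<^sup>2 + 3 * (4 * x2 + x4)\<^sup>2 + 2 * (3 * x3 - x4)\<^sup>2 + 13 * x4\<^sup>2"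
      using Q_sum_of_squares[of x1 x2 x3 x4] by simp
    moreover note zero_le_power2[of "2 * x1 + x3 + x4"] zero_le_power2[of "4 * x2 + x4"]
      zero_le_power2[of "3 * x3 - x4"] zero_le_power2[of x4]
    ultimately have "x4\<^sup>2 < 4" "(3 * x3 - x4)\<^sup>2 < 16" "(4 * x2 + x4)\<^sup>2 < 9" "(2 * x1 + x3 + x4)\<^sup>2 < 9"
      by linarith+
    then have "\<bar>x4\<bar> \<le> 1" "\<bar>3 * x3 - x4\<bar> \<le> 3" "\<bar>4 * x2 + x4\<bar> \<le> 2" "\<bar>2 * x1 + x3 + x4\<bar> \<le> 2"
      using small[of x4 1] small[of "3 * x3 - x4" 3] small[of "4 * x2 + x4" 2] small[of "2 * x1 + x3 + x4" 2]
      by simp_all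
    then have "x4 \<in> {-1, 0, 1}" "x3 \<in> {-1, 0, 1}" "x2 = 0" "x1 \<in> {-2, -1, 0, 1, 2}" by auto
    then show "x \<in> ?S" using Q1 unfolding x by (elim insertE emptyE) (simp_all add: Q_def)
  qed
  then have "card {x. Q x = 1} \<le> card ?S" by (rule card_mono[rotated]) simp
  moreover have "card ?S \<le> 12" by simp
  ultimately show "card {x. Q x = 1} \<le> 12" by linarith
  have "(1,0,0,0) \<in> {x. Q x = 1}" by (simp add: Q_def)
  then show "card {x. Q x = 1} > 0" using card_level_set(2)[OF pos_form13_Q, of 1] card_gt_0_iff by blast
qed

lemma card_level_13: "card {x. Q x = 13} > 12"
proof -
  let ?S = "{(4,0,0,-1), (4,0,0,-3), (4,0,-1,0), (3,0,1,0), (3,0,0,1), (1,0,3,0), (1,0,0,3),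
    (-4,0,0,1), (-4,0,0,3), (-4,0,1,0), (-3,0,-1,0), (-3,0,0,-1), (-1,0,-3,0)} :: vec set"
  have "?S \<subseteq> {x. Q x = 13}" by (simp add: Q_def)
  then have "card ?S \<le> card {x. Q x = 13}" using card_level_set(2)[OF pos_form13_Q] by (intro card_mono)
  then show ?thesis by simp
qed

theorem proposition4p3:
  fixes p :: nat
  assumes "prime p"
    and "int (r_Q p) = int (r_Q 1) * (1 + chi (int p) * int p)
       \<or> int (r_Q (p\<^sup>2)) = int (r_Q 1) * (1 + chi (int p) * int p + (int p)\<^sup>2)"
  shows "\<forall>n::nat. n \<ge> 1 \<and> coprime n p \<longrightarrow>
    real (r_Q (p\<^sup>2 * n)) = real (r_Q (p\<^sup>2)) * real (r_Q n) / real (r_Q 1)"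
proof (intro allI impI)
  fix n :: nat assume n: "n \<ge> 1 \<and> coprime n p"
  have r1: "r_Q 1 > 0" "r_Q 1 \<le> 12" using card_level_1 by (simp_all add: r_Q_def)
  have "p \<noteq> 13"
  proof
    assume p: "p = 13"
    have "chi (int p) = 0" by (simp add: p chi_def)
    moreover have "r_Q 13 > 12" "r_Q 169 = 183 * r_Q 1"
      using card_level_13 card_level_169 by (simp_all add: r_Q_def)
    ultimately show False using assms(2) r1 by (simp add: p)
  qed
  then have P: "prime (int p)" "int p \<noteq> 13" using assms(1) by auto
  define K where "K = int (card (cone (int p))) - (int p)\<^sup>2 + int p"
  have "\<not> p dvd n" using n assms(1) by (metis coprime_commute coprime_absorb_left not_prime_unit)
  then have "\<not> int p dvd int n" by simp
  from hecke_relation[OF P this] have a: "(int p - 1) * int (r_Q (p\<^sup>2 * n)) = K * int (r_Q n)"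
    by (simp add: K_def r_Q_def)
  have "\<not> int p dvd 1" using P(1) not_prime_unit by blast
  from hecke_relation[OF P this] have b: "(int p - 1) * int (r_Q (p\<^sup>2)) = K * int (r_Q 1)"
    by (simp add: K_def r_Q_def)
  have "(int p - 1) * (int (r_Q (p\<^sup>2 * n)) * int (r_Q 1)) = K * int (r_Q n) * int (r_Q 1)"
    by (simp only: a[symmetric] mult.assoc)
  also have "\<dots> = K * int (r_Q 1) * int (r_Q n)" by simp
  also have "\<dots> = (int p - 1) * (int (r_Q (p\<^sup>2)) * int (r_Q n))" by (simp only: b[symmetric] mult.assoc)
  finally have "(int p - 1) * (int (r_Q (p\<^sup>2 * n)) * int (r_Q 1))
    = (int p - 1) * (int (r_Q (p\<^sup>2)) * int (r_Q n))" .
  moreover have "int p - 1 \<noteq> 0" using prime_gt_1_nat[OF assms(1)] by simp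
  ultimately have "int (r_Q (p\<^sup>2 * n) * r_Q 1) = int (r_Q (p\<^sup>2) * r_Q n)" by simp
  then have "r_Q (p\<^sup>2 * n) * r_Q 1 = r_Q (p\<^sup>2) * r_Q n" by (simp only: of_nat_eq_iff)
  then have "real (r_Q (p\<^sup>2 * n)) * real (r_Q 1) = real (r_Q (p\<^sup>2)) * real (r_Q n)"
    by (metis of_nat_mult)
  then show "real (r_Q (p\<^sup>2 * n)) = real (r_Q (p\<^sup>2)) * real (r_Q n) / real (r_Q 1)"
    using r1 by (simp add: field_simps)
qed

end
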